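(* Let $T\in\mathbb{N}$, $p\in(1,\infty)$, $q=p/(p-1)$ and $P\in\mathcal{P}_p(\mathbb{R}^T)$. Let $f\colon\mathbb{R}^T\to\mathbb{R}$ be continuously differentiable and assume that there exists $c>0$ such that $$\sum_{s=1}^T |\partial_{x_s} f(x)| \le c \Big(1+\sum_{s=1}^T |x_s|^{p-1} \Big)\qquad\text{for every } x\in\mathbb{R}^T.$$ Then, as $r\downarrow 0$, $$\sup_{Q\in B_r(P)} E_Q[f(X)] = E_P[f(X)]+ r\cdot \Big( \sum_{t=1}^T E_P\Big[ \big| E_P[ \partial_{x_t} f(X) \,|\, \mathcal{F}^X_t ] \big|^q \Big]\Big)^{1/q} + o(r).$$
   Context: $\mathcal{P}_p(\mathbb{R}^T)$ is the set of Borel probability measures on $\mathbb{R}^T$ with finite $p$-th moment. $X=(X_t)_{t=1}^T$ is the canonical process (identity map) on $\mathbb{R}^T$, and $\mathcal{F}^X_t=\sigma(X_s: s\le t)$, with $\mathcal{F}^X_0$ trivial. $\partial_{x_t}f$ is the partial derivative in the $t$-th coordinate. On $\mathbb{R}^T\times\mathbb{R}^T$, let $X,Y$ denote the projections to the first and second coordinate. A coupling $\pi$ between $P,Q\in\mathcal{P}_p(\mathbb{R}^T)$ is a Borel probability measure on $\mathbb{R}^T\times\mathbb{R}^T$ with first marginal $P$ and second marginal $Q$. It is causal if, $\pi$-almost surely, $\pi((Y_1,\dots,Y_t)\in A\,|\,X_1,\dots,X_T)=\pi((Y_1,\dots,Y_t)\in A\,|\,X_1,\dots,X_t)$ for all Borel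 $A\subseteq\mathbb{R}^t$ and all $1\le t\le T$. It is bicausal if it is causal and the same condition holds with the roles of $X$ and $Y$ reversed. The adapted Wasserstein distance is $\mathcal{AW}_p(P,Q)=\inf_\pi\big(\sum_{t=1}^T E_\pi[|X_t-Y_t|^p]\big)^{1/p}$, where the infimum is over all bicausal couplings $\pi$ between $P$ and $Q$. For $r\ge 0$, $B_r(P)=\{Q\in\mathcal{P}_p(\mathbb{R}^T):\mathcal{AW}_p(P,Q)\le r\}$. *)

theory Defs
  imports "HOL-Probability.Probability" "HOL-Library.Landau_Symbols"
begin

text \<open>
  Paths in \<open>R^T\<close> are vectors \<open>real ^ 'n\<close> over a finite, linearly ordered index type \<open>'n\<close>
  of time points, with \<open>T = CARD('n)\<close>; \<open>s \<le> t\<close> is the order of time.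
\<close>

definition finite_moment_measures :: "real \<Rightarrow> (real ^ 'n::finite) measure set" where
  "finite_moment_measures p = {P. prob_space P \<and> sets P = sets borel \<and> integrable P (\<lambda>x. norm x powr p)}"

text \<open>The sigma-algebra generated by the coordinates \<open>Z\<^sub>s\<close>, \<open>s \<in> S\<close>, of a process \<open>Z\<close>;
  it is trivial for \<open>S = {}\<close>.\<close>
definition process_algebra :: "('a \<Rightarrow> real ^ 'n::finite) \<Rightarrow> 'n set \<Rightarrow> 'a measure" where
  "process_algebra Z S = sigma UNIV {(\<lambda>\<omega>. Z \<omega> $ s) -` A | s A. s \<in> S \<and> A \<in> sets borel}"

definition partial_deriv :: "'n::finite \<Rightarrow> (real ^ 'n \<Rightarrow> real) \<Rightarrow> real ^ 'n \<Rightarrow> real" where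
  "partial_deriv t f x = deriv (\<lambda>h. f (x + h *\<^sub>R axis t 1)) 0"

definition continuously_differentiable :: "(real ^ 'n::finite \<Rightarrow> real) \<Rightarrow> bool" where
  "continuously_differentiable f \<longleftrightarrow>
     (\<exists>f' :: real ^ 'n \<Rightarrow> (real ^ 'n) \<Rightarrow>\<^sub>L real.
        (\<forall>x. (f has_derivative blinfun_apply (f' x)) (at x)) \<and> continuous_on UNIV f')"

definition couplings ::
  "(real ^ 'n::finite) measure \<Rightarrow> (real ^ 'n) measure \<Rightarrow> ((real ^ 'n) \<times> (real ^ 'n)) measure set" where
  "couplings P Q = {\<pi>. prob_space \<pi> \<and> sets \<pi> = sets borel \<and>
                       distr \<pi> borel fst = P \<and> distr \<pi> borel snd = Q}"

text \<open>Conditional probabilities are conditional expectations of indicators, determined up to a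
  null set for each event, hence the almost sure quantifier inside. Borel subsets of \<open>R^t\<close> are
  the measurable sets of the product over the time points up to \<open>t\<close>.\<close>
definition causal ::
  "'a measure \<Rightarrow> ('a \<Rightarrow> real ^ 'n::{finite,linorder}) \<Rightarrow> ('a \<Rightarrow> real ^ 'n::{finite,linorder}) \<Rightarrow> bool" where
  "causal \<pi> X Y \<longleftrightarrow>
     (\<forall>t. \<forall>A \<in> sets (\<Pi>\<^sub>M s\<in>{..t}. (borel :: real measure)).
        AE \<omega> in \<pi>.
          real_cond_exp \<pi> (process_algebra X UNIV) (indicator {\<omega>. (\<lambda>s\<in>{..t}. Y \<omega> $ s) \<in> A}) \<omega>
        = real_cond_exp \<pi> (process_algebra X {..t}) (indicator {\<omega>. (\<lambda>s\<in>{..t}. Y \<omega> $ s) \<in> A}) \<omega>)"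

definition bicausal_couplings ::
  "(real ^ 'n::{finite,linorder}) measure \<Rightarrow> (real ^ 'n::{finite,linorder}) measure
     \<Rightarrow> ((real ^ 'n::{finite,linorder}) \<times> (real ^ 'n::{finite,linorder})) measure set" where
  "bicausal_couplings P Q = {\<pi> \<in> couplings P Q. causal \<pi> fst snd \<and> causal \<pi> snd fst}"

text \<open>Meaningful for \<open>P, Q\<close> with finite \<open>p\<close>-th moment only: then every integrand below is
  integrable and the set of bicausal couplings contains the product measure.\<close>
definition adapted_wasserstein ::
  "real \<Rightarrow> (real ^ 'n::{finite,linorder}) measure \<Rightarrow> (real ^ 'n::{finite,linorder}) measure \<Rightarrow> real" where
  "adapted_wasserstein p P Q =
     (INF \<pi>\<in>bicausal_couplings P Q.
        (\<Sum>t\<in>UNIV. \<integral>\<omega>. \<bar>fst \<omega> $ t - snd \<omega> $ t\<bar> powr p \<partial>\<pi>) powr (1 / p))"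

definition adapted_ball ::
  "real \<Rightarrow> (real ^ 'n::{finite,linorder}) measure \<Rightarrow> real \<Rightarrow> (real ^ 'n::{finite,linorder}) measure set" where
  "adapted_ball p P r = {Q \<in> finite_moment_measures p. adapted_wasserstein p P Q \<le> r}"

end

theory Submission
  imports Defs
begin

text \<open>
  Write \<open>V\<close> for the coefficient of \<open>r\<close> (\<open>sens\<close> below), the \<open>L\<^sup>q\<close> norm of the projected gradient
  \<open>E\<^sub>P[\<partial>\<^sub>t f(X) | X\<^sub>s, s \<le> t]\<close>. The starting point is an expansion that knows nothing of
  causality (\<open>first_order_expansion\<close>): for a coupling \<open>\<pi>\<close> of \<open>P\<close> and \<open>Q\<close> of cost at most \<open>r\<close>,
  \<open>E\<^sub>Q f - E\<^sub>P f\<close> equals the sum over \<open>t\<close> of \<open>E\<^sub>\<pi>[\<partial>\<^sub>t f(X) (Y\<^sub>t - X\<^sub>t)]\<close> up to \<open>o(r)\<close>, uniformly in \<open>Q\<close>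
  and \<open>\<pi>\<close>. It rests on a pointwise remainder estimate, which uses uniform continuity of the
  gradient on a ball, smallness of the \<open>p\<close>-th moment of \<open>P\<close> outside it, and the growth condition
  for large increments.

  Upper bound: if \<open>\<pi>\<close> is causal, then \<open>Y\<^sub>t\<close> and the whole path \<open>X\<close> are independent conditionally on
  \<open>X\<close> up to time \<open>t\<close>, so that \<open>\<partial>\<^sub>t f(X)\<close> may be replaced by its projection (\<open>causal_integral\<close>).
  Hoelder's inequality then bounds the first order term by \<open>V r\<close>.

  Lower bound: the equality case of Hoelder's inequality suggests to move \<open>X\<^sub>t\<close> by \<open>r Z\<^sub>t\<close>, where
  \<open>Z\<^sub>t\<close> depends on \<open>X\<close> up to time \<open>t\<close> and is proportional to the sign of the projected gradient times
  the \<open>(q - 1)\<close>-th power of its absolute value. The resulting coupling is causal, but in general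
  not bicausal, as the past of \<open>X\<close> need not be recoverable from the past of \<open>X + r Z\<close>. Bounded
  Lipschitz functions of the past are dense in \<open>L\<^sup>p\<close> of the past (\<open>test_functions_dense\<close>), so \<open>Z\<close>
  may be replaced by an adapted Lipschitz \<open>\<phi>\<close>. For small \<open>r\<close> the map \<open>x \<mapsto> x + r \<phi>(x)\<close> is then a
  bijection with adapted inverse (\<open>test_functions_perturbation_invertible\<close>), which makes the
  coupling bicausal.
\<close>

section \<open>Power inequalities and Hoelder's inequality\<close>

lemma powr_convex_combination:
  fixes p u v l :: real
  assumes p: "1 \<le> p" and uv: "0 \<le> u" "0 \<le> v" and l: "0 < l" "l < 1"
  shows "((1 - l) * u + l * v) powr p \<le> (1 - l) * u powr p + l * v powr p"
proof -
  have small: "(m * w) powr p \<le> m * w powr p" if "0 < m" "m < 1" "0 \<le> w" for m w :: real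
  proof -
    have "m powr p \<le> m powr 1" using that p by (intro powr_mono') auto
    then show ?thesis using that by (simp add: powr_mult mult_right_mono)
  qed
  consider "u = 0" | "v = 0" | "0 < u" "0 < v" using uv by fastforce
  then show ?thesis
  proof cases
    case 1 then show ?thesis using small[of l v] l uv by simp
  next
    case 2 then show ?thesis using small[of "1 - l" u] l uv by simp
  next
    case 3 then show ?thesis
      using convex_onD[OF powr_convex[OF p], of l u v] l by simp
  qed
qed

lemma abs_powr_convex:
  fixes p :: real
  assumes p: "1 \<le> p"
  shows "convex_on UNIV (\<lambda>x::real. \<bar>x\<bar> powr p)"
proof (rule convex_onI)
  fix t x y :: real
  assume t: "0 < t" "t < 1"
  have "\<bar>(1 - t) *\<^sub>R x + t *\<^sub>R y\<bar> \<le> \<bar>(1 - t) * x\<bar> + \<bar>t * y\<bar>" 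
    using abs_triangle_ineq[of "(1 - t) * x" "t * y"] by simp
  also have "\<dots> = (1 - t) * \<bar>x\<bar> + t * \<bar>y\<bar>" using t by (simp add: abs_mult)
  finally have "\<bar>(1 - t) *\<^sub>R x + t *\<^sub>R y\<bar> powr p \<le> ((1 - t) * \<bar>x\<bar> + t * \<bar>y\<bar>) powr p"
    using p by (intro powr_mono2) auto
  also have "\<dots> \<le> (1 - t) * \<bar>x\<bar> powr p + t * \<bar>y\<bar> powr p"
    using powr_convex_combination[OF p _ _ t] by simp
  finally show "\<bar>(1 - t) *\<^sub>R x + t *\<^sub>R y\<bar> powr p \<le> (1 - t) * \<bar>x\<bar> powr p + t * \<bar>y\<bar> powr p" .
qed simp

lemma le_one_plus_powr:
  fixes y p :: real
  assumes "1 \<le> p"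
  shows "y \<le> 1 + y powr p"
proof (cases "y \<le> 1")
  case False
  then show ?thesis using powr_mono[OF assms, of y] by simp
qed (simp add: add_increasing2)

lemma sum_powr_le:
  fixes a :: "'i \<Rightarrow> real" and p :: real
  assumes I: "finite I" and a: "\<And>i. i \<in> I \<Longrightarrow> 0 \<le> a i" and p: "0 < p"
  shows "(\<Sum>i\<in>I. a i) powr p \<le> real (card I) powr p * (\<Sum>i\<in>I. a i powr p)"
proof (cases "I = {}")
  case False
  define m where "m = Max (a ` I)"
  have mI: "m \<in> a ` I" unfolding m_def using I False by (intro Max_in) auto
  have m0: "0 \<le> m" using mI a by auto
  have "(\<Sum>i\<in>I. a i) \<le> (\<Sum>i\<in>I. m)" unfolding m_def using I by (intro sum_mono) auto
  also have "\<dots> = real (card I) * m" by simp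
  finally have "(\<Sum>i\<in>I. a i) powr p \<le> (real (card I) * m) powr p"
    using a p by (intro powr_mono2 sum_nonneg) auto
  also have "\<dots> = real (card I) powr p * m powr p" using m0 by (simp add: powr_mult)
  also have "m powr p \<le> (\<Sum>i\<in>I. a i powr p)"
    using mI I by (auto intro!: member_le_sum)
  finally show ?thesis by (simp add: mult_left_mono)
qed simp

lemma add_powr_le:
  fixes a b p :: real
  assumes "0 \<le> a" "0 \<le> b" "0 < p"
  shows "(a + b) powr p \<le> 2 powr p * (a powr p + b powr p)"
proof -
  have "(a + b) powr p \<le> (2 * max a b) powr p" using assms by (intro powr_mono2) auto
  also have "\<dots> = 2 powr p * max a b powr p" using assms by (simp add: powr_mult)
  also have "max a b powr p \<le> a powr p + b powr p" by (auto simp: max_def)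
  finally show ?thesis by (simp add: mult_left_mono)
qed

lemma norm_powr_le_sum:
  fixes x :: "real ^ 'n::finite"
  assumes "0 < p"
  shows "norm x powr p \<le> real CARD('n) powr p * (\<Sum>t\<in>UNIV. \<bar>x $ t\<bar> powr p)"
proof -
  have "norm x powr p \<le> (\<Sum>t\<in>UNIV. \<bar>x $ t\<bar>) powr p"
    using assms norm_le_l1_cart[of x] by (intro powr_mono2) auto
  also have "\<dots> \<le> real CARD('n) powr p * (\<Sum>t\<in>UNIV. \<bar>x $ t\<bar> powr p)"
    using assms by (intro sum_powr_le) auto
  finally show ?thesis .
qed

lemma sum_powr_le_norm:
  fixes x :: "real ^ 'n::finite"
  assumes "0 < p"
  shows "(\<Sum>t\<in>UNIV. \<bar>x $ t\<bar> powr p) \<le> real CARD('n) * norm x powr p"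
proof -
  have "(\<Sum>t\<in>UNIV. \<bar>x $ t\<bar> powr p) \<le> (\<Sum>t\<in>(UNIV::'n set). norm x powr p)"
    using assms by (intro sum_mono powr_mono2 component_le_norm_cart) auto
  then show ?thesis by simp
qed

text \<open>\<open>p > 1\<close> and its conjugate exponent \<open>q\<close>, that is \<open>1 / p + 1 / q = 1\<close>.\<close>

definition conjugate_exponents :: "real \<Rightarrow> real \<Rightarrow> bool" where
  "conjugate_exponents p q \<longleftrightarrow> 1 < p \<and> q = p / (p - 1)"

lemma conjugate_exponentsD:
  assumes "conjugate_exponents p q"
  shows "1 < p" "1 < q" "(p - 1) * q = p" "(q - 1) * p = q" "1 / p + 1 / q = 1"
    "conjugate_exponents q p"
  using assms unfolding conjugate_exponents_def by (auto simp: field_simps)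

lemma integrable_mult_conjugate:
  fixes a b :: "'a \<Rightarrow> real"
  assumes pq: "conjugate_exponents p q"
    and [measurable]: "a \<in> borel_measurable M" "b \<in> borel_measurable M"
    and a: "integrable M (\<lambda>x. \<bar>a x\<bar> powr q)" and b: "integrable M (\<lambda>x. \<bar>b x\<bar> powr p)"
  shows "integrable M (\<lambda>x. a x * b x)"
proof (rule Bochner_Integration.integrable_bound)
  show "integrable M (\<lambda>x. \<bar>a x\<bar> powr q / q + \<bar>b x\<bar> powr p / p)" using a b by auto
  have "\<bar>a x\<bar> * \<bar>b x\<bar> \<le> \<bar>a x\<bar> powr q / q + \<bar>b x\<bar> powr p / p" for x
    using Youngs_inequality[of q p "\<bar>a x\<bar>" "\<bar>b x\<bar>"] conjugate_exponentsD[OF pq] by auto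
  then show "AE x in M. norm (a x * b x) \<le> norm (\<bar>a x\<bar> powr q / q + \<bar>b x\<bar> powr p / p)"
    using conjugate_exponentsD[OF pq] by (intro AE_I2) (auto simp: abs_mult intro: order_trans[OF _ abs_ge_self])
qed simp

text \<open>Hoelder's inequality on the product of a finite set and a measure space. It is stated
  with upper bounds \<open>A, B > 0\<close> of the two norms, so that norms equal to zero need no separate
  treatment.\<close>

lemma Hoelder_sum_integral:
  fixes a b :: "'i \<Rightarrow> 'a \<Rightarrow> real"
  assumes pq: "conjugate_exponents p q"
    and meas: "\<And>i. i \<in> I \<Longrightarrow> a i \<in> borel_measurable M" "\<And>i. i \<in> I \<Longrightarrow> b i \<in> borel_measurable M"
    and a: "\<And>i. i \<in> I \<Longrightarrow> integrable M (\<lambda>x. \<bar>a i x\<bar> powr q)"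
    and b: "\<And>i. i \<in> I \<Longrightarrow> integrable M (\<lambda>x. \<bar>b i x\<bar> powr p)"
    and A: "0 < A" "(\<Sum>i\<in>I. \<integral>x. \<bar>a i x\<bar> powr q \<partial>M) \<le> A powr q"
    and B: "0 < B" "(\<Sum>i\<in>I. \<integral>x. \<bar>b i x\<bar> powr p \<partial>M) \<le> B powr p"
  shows "(\<Sum>i\<in>I. \<integral>x. \<bar>a i x * b i x\<bar> \<partial>M) \<le> A * B"
proof -
  note pqD = conjugate_exponentsD[OF pq]
  let ?a = "A powr q" and ?b = "B powr p"
  have young: "\<bar>a i x * b i x\<bar> \<le> A * B / (q * ?a) * \<bar>a i x\<bar> powr q + A * B / (p * ?b) * \<bar>b i x\<bar> powr p"
    for i x
  proof -
    have "(\<bar>a i x\<bar> / A) * (\<bar>b i x\<bar> / B) \<le> (\<bar>a i x\<bar> / A) powr q / q + (\<bar>b i x\<bar> / B) powr p / p"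
      using Youngs_inequality[of q p "\<bar>a i x\<bar> / A" "\<bar>b i x\<bar> / B"] pqD A B by auto
    then have "A * B * ((\<bar>a i x\<bar> / A) * (\<bar>b i x\<bar> / B))
        \<le> A * B * (\<bar>a i x\<bar> powr q / ?a / q + \<bar>b i x\<bar> powr p / ?b / p)"
      using A B by (intro mult_left_mono) (auto simp: powr_divide)
    then show ?thesis using A B by (simp add: abs_mult field_simps)
  qed
  have "(\<Sum>i\<in>I. \<integral>x. \<bar>a i x * b i x\<bar> \<partial>M)
      \<le> (\<Sum>i\<in>I. \<integral>x. A * B / (q * ?a) * \<bar>a i x\<bar> powr q + A * B / (p * ?b) * \<bar>b i x\<bar> powr p \<partial>M)"
    using integrable_mult_conjugate[OF pq meas a b] a b young
    by (intro sum_mono integral_mono integrable_abs) auto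
  also have "\<dots> = A * B / (q * ?a) * (\<Sum>i\<in>I. \<integral>x. \<bar>a i x\<bar> powr q \<partial>M)
      + A * B / (p * ?b) * (\<Sum>i\<in>I. \<integral>x. \<bar>b i x\<bar> powr p \<partial>M)"
    using a b by (simp add: sum.distrib sum_distrib_left)
  also have "\<dots> \<le> A * B / (q * ?a) * ?a + A * B / (p * ?b) * ?b"
    using A B pqD by (intro add_mono mult_left_mono) auto
  also have "\<dots> = A * B * (1 / p + 1 / q)" using A B by (simp add: field_simps)
  finally show ?thesis using pqD by simp
qed

section \<open>Causality\<close>

lemma space_process_algebra [simp]: "space (process_algebra Z S) = UNIV"
  by (simp add: process_algebra_def)

lemma sets_process_algebra:
  "sets (process_algebra Z S)
     = sigma_sets UNIV {(\<lambda>\<omega>. Z \<omega> $ s) -` A | s A. s \<in> S \<and> A \<in> sets borel}"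
  by (simp add: process_algebra_def)

lemma measurable_process_algebra_coordinate:
  assumes "s \<in> S"
  shows "(\<lambda>\<omega>. Z \<omega> $ s) \<in> borel_measurable (process_algebra Z S)"
  using assms by (intro measurableI) (auto simp: sets_process_algebra intro!: sigma_sets.Basic exI[of _ s])

lemma sets_process_algebra_mono:
  assumes "S \<subseteq> S'"
  shows "sets (process_algebra Z S) \<subseteq> sets (process_algebra Z S')"
  unfolding sets_process_algebra using assms by (intro sigma_sets_mono') auto

lemma measurable_vec_nth [measurable (raw)]:
  "f \<in> borel_measurable M \<Longrightarrow> (\<lambda>x. (f x :: real ^ 'n::finite) $ s) \<in> borel_measurable M"
  by (rule measurable_compose[OF _ borel_measurable_nth])

lemma subalgebra_process_algebra:
  assumes [measurable]: "Z \<in> borel_measurable M" and M: "space M = UNIV"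
  shows "subalgebra M (process_algebra Z S)"
  unfolding subalgebra_def
proof
  show "sets (process_algebra Z S) \<subseteq> sets M"
    unfolding sets_process_algebra M[symmetric]
  proof (rule sets.sigma_sets_subset, safe)
    fix s A assume [measurable]: "A \<in> sets (borel :: real measure)"
    have "(\<lambda>\<omega>. Z \<omega> $ s) -` A \<inter> space M \<in> sets M" by measurable
    then show "(\<lambda>\<omega>. Z \<omega> $ s) -` A \<in> sets M" by (simp add: M)
  qed
qed (simp add: M)

text \<open>The algebra of a process \<open>Z\<close> is the preimage under \<open>Z\<close> of the algebra of the canonical
  process.\<close>

lemma sets_process_algebra_vimage:
  "sets (process_algebra Z S) = {Z -` B | B. B \<in> sets (process_algebra (\<lambda>x. x) S)}"
proof -
  let ?G = "{(\<lambda>x. x $ s) -` A | s A. s \<in> S \<and> A \<in> sets borel}"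
  have "{Z -` B \<inter> UNIV | B. B \<in> sigma_sets UNIV ?G} = sigma_sets UNIV {Z -` B \<inter> UNIV | B. B \<in> ?G}"
    by (rule sigma_sets_vimage_commute) simp
  also have "{Z -` B \<inter> UNIV | B. B \<in> ?G} = {(\<lambda>\<omega>. Z \<omega> $ s) -` A | s A. s \<in> S \<and> A \<in> sets borel}"
    (is "?L = ?R")
  proof
    show "?L \<subseteq> ?R" by (auto simp: vimage_comp comp_def)
    show "?R \<subseteq> ?L"
    proof safe
      fix s :: 'b and A :: "real set" assume "s \<in> S" "A \<in> sets borel"
      then show "\<exists>B. (\<lambda>\<omega>. Z \<omega> $ s) -` A = Z -` B \<inter> UNIV \<and> B \<in> ?G"
        by (intro exI[of _ "(\<lambda>x. x $ s) -` A"]) auto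
    qed
  qed
  finally show ?thesis by (simp add: sets_process_algebra)
qed

lemma measurable_process_algebra_process:
  "Z \<in> measurable (process_algebra Z S) (process_algebra (\<lambda>x. x) S)"
  by (rule measurableI) (auto simp: sets_process_algebra_vimage[of Z])

text \<open>Continuity makes the restriction to the coordinates in \<open>S\<close> measurable for \<open>\<sigma>(X\<^sub>s : s \<in> S)\<close>
  as soon as it is all that the function sees.\<close>

lemma measurable_process_algebra_continuous:
  fixes g :: "real ^ 'n::finite \<Rightarrow> real"
  assumes cont: "continuous_on UNIV g"
    and dep: "\<And>x y. (\<And>s. s \<in> S \<Longrightarrow> x $ s = y $ s) \<Longrightarrow> g x = g y"
  shows "g \<in> borel_measurable (process_algebra (\<lambda>x. x) S)"
proof -
  let ?pr = "\<lambda>x :: real ^ 'n. (\<chi> s. if s \<in> S then x $ s else 0) :: real ^ 'n"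
  have "(\<lambda>x. ?pr x $ s) \<in> borel_measurable (process_algebra (\<lambda>x. x) S)" for s
    using measurable_process_algebra_coordinate[of s S "\<lambda>x. x"] by (cases "s \<in> S") auto
  then have "?pr \<in> borel_measurable (process_algebra (\<lambda>x. x) S)"
    by (subst borel_measurable_euclidean_space) (auto simp: Basis_vec_def inner_axis)
  moreover have "g \<in> borel_measurable borel" using cont by (rule borel_measurable_continuous_onI)
  ultimately have "(\<lambda>x. g (?pr x)) \<in> borel_measurable (process_algebra (\<lambda>x. x) S)"
    by (rule measurable_compose)
  moreover have "g (?pr x) = g x" for x by (rule dep) simp
  ultimately show ?thesis by simp
qed

text \<open>A continuous map of path space is adapted if its values up to time \<open>t\<close> depend on the path
  up to time \<open>t\<close> only.\<close>

definition adapted_map :: "(real ^ 'n::{finite,linorder} \<Rightarrow> real ^ 'n::{finite,linorder}) \<Rightarrow> bool" where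
  "adapted_map \<Psi> \<longleftrightarrow> continuous_on UNIV \<Psi> \<and>
     (\<forall>t x y. (\<forall>s\<le>t. x $ s = y $ s) \<longrightarrow> (\<forall>s\<le>t. \<Psi> x $ s = \<Psi> y $ s))"

lemma adapted_map_measurable:
  assumes "adapted_map \<Psi>"
  shows "\<Psi> \<in> borel_measurable borel"
  using assms unfolding adapted_map_def by (auto intro: borel_measurable_continuous_onI)

lemma restricted_path_event_measurable:
  fixes Y :: "'a \<Rightarrow> real ^ 'n::{finite,linorder}"
  assumes "A \<in> sets (\<Pi>\<^sub>M s\<in>{..t}. (borel :: real measure))"
    and "\<And>s. s \<le> t \<Longrightarrow> (\<lambda>\<omega>. Y \<omega> $ s) \<in> borel_measurable M" and "space M = UNIV"
  shows "{\<omega>. (\<lambda>s\<in>{..t}. Y \<omega> $ s) \<in> A} \<in> sets M"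
proof -
  have "(\<lambda>\<omega>. \<lambda>s\<in>{..t}. Y \<omega> $ s) \<in> measurable M (\<Pi>\<^sub>M s\<in>{..t}. (borel :: real measure))"
    using assms(2) by (intro measurable_restrict) auto
  from measurable_sets[OF this assms(1)] show ?thesis by (simp add: assms(3) vimage_def)
qed

lemma prob_space_subalgebra:
  assumes "prob_space M" "subalgebra M F"
  shows "sigma_finite_subalgebra M F"
  using assms by (intro finite_measure_subalgebra_is_sigma_finite)
    (simp add: finite_measure_subalgebra_def finite_measure_subalgebra_axioms_def
      prob_space.finite_measure)

text \<open>If \<open>Y = \<Psi>(X)\<close> for an adapted \<open>\<Psi>\<close>, then events about \<open>Y\<close> up to time \<open>t\<close> are almost surely
  events about \<open>X\<close> up to time \<open>t\<close>, so both conditional probabilities are the indicator.\<close>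

lemma causal_adapted_map:
  fixes X Y :: "'a \<Rightarrow> real ^ 'n::{finite,linorder}"
  assumes "prob_space \<pi>" and sp: "space \<pi> = UNIV"
    and X[measurable]: "X \<in> borel_measurable \<pi>" and Y[measurable]: "Y \<in> borel_measurable \<pi>"
    and \<Psi>: "adapted_map \<Psi>" and YX: "AE \<omega> in \<pi>. Y \<omega> = \<Psi> (X \<omega>)"
  shows "causal \<pi> X Y"
  unfolding causal_def
proof (intro allI ballI)
  fix t :: 'n and A assume A: "A \<in> sets (\<Pi>\<^sub>M s\<in>{..t}. (borel :: real measure))"
  interpret prob_space \<pi> by fact
  define W where "W = {\<omega>. (\<lambda>s\<in>{..t}. Y \<omega> $ s) \<in> A}"
  define B where "B = {x. (\<lambda>s\<in>{..t}. \<Psi> x $ s) \<in> A}"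
  have W[measurable]: "W \<in> sets \<pi>"
    unfolding W_def by (rule restricted_path_event_measurable[OF A _ sp]) measurable
  have "B \<in> sets (process_algebra (\<lambda>x. x) {..t})" unfolding B_def
  proof (rule restricted_path_event_measurable[OF A])
    fix s assume "s \<le> t"
    show "(\<lambda>x. \<Psi> x $ s) \<in> borel_measurable (process_algebra (\<lambda>x. x) {..t})"
    proof (rule measurable_process_algebra_continuous)
      show "continuous_on UNIV (\<lambda>x. \<Psi> x $ s)"
        using \<Psi> by (auto simp: adapted_map_def intro: continuous_intros)
    next
      fix x y :: "(real, 'n) vec" assume "\<And>s. s \<in> {..t} \<Longrightarrow> x $ s = y $ s"
      then show "\<Psi> x $ s = \<Psi> y $ s"
        using \<Psi> \<open>s \<le> t\<close> unfolding adapted_map_def by (metis atMost_iff)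
    qed
  qed simp
  then have XB: "X -` B \<in> sets (process_algebra X {..t})"
    by (auto simp: sets_process_algebra_vimage[of X])
  have ce: "AE \<omega> in \<pi>. real_cond_exp \<pi> F (indicator W) \<omega> = indicator (X -` B) \<omega>"
    if F: "subalgebra \<pi> F" and XBF: "X -` B \<in> sets F" for F
  proof -
    interpret F: sigma_finite_subalgebra \<pi> F
      using prob_space_axioms F by (rule prob_space_subalgebra)
    have [measurable]: "X -` B \<in> sets \<pi>" using F XBF by (auto simp: subalgebra_def)
    have "AE \<omega> in \<pi>. (indicator W \<omega> :: real) = indicator (X -` B) \<omega>"
      using YX by eventually_elim (auto simp: W_def B_def indicator_def)
    then have "AE \<omega> in \<pi>. real_cond_exp \<pi> F (indicator W) \<omega>
        = real_cond_exp \<pi> F (indicator (X -` B)) \<omega>"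
      by (rule F.real_cond_exp_cong) auto
    moreover have "AE \<omega> in \<pi>. real_cond_exp \<pi> F (indicator (X -` B)) \<omega> = indicator (X -` B) \<omega>"
      using XBF by (intro F.real_cond_exp_F_meas integrable_real_indicator) (auto simp: less_top[symmetric])
    ultimately show ?thesis by eventually_elim simp
  qed
  have "AE \<omega> in \<pi>. real_cond_exp \<pi> (process_algebra X UNIV) (indicator W) \<omega> = indicator (X -` B) \<omega>"
    using XB sets_process_algebra_mono[of "{..t}" UNIV X]
    by (intro ce subalgebra_process_algebra X sp) auto
  moreover have "AE \<omega> in \<pi>. real_cond_exp \<pi> (process_algebra X {..t}) (indicator W) \<omega> = indicator (X -` B) \<omega>"
    using XB by (intro ce subalgebra_process_algebra X sp)
  ultimately show "AE \<omega> in \<pi>.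
      real_cond_exp \<pi> (process_algebra X UNIV) (indicator {\<omega>. (\<lambda>s\<in>{..t}. Y \<omega> $ s) \<in> A}) \<omega>
    = real_cond_exp \<pi> (process_algebra X {..t}) (indicator {\<omega>. (\<lambda>s\<in>{..t}. Y \<omega> $ s) \<in> A}) \<omega>"
    unfolding W_def by eventually_elim simp
qed

text \<open>Independence of \<open>X\<close> and \<open>Y\<close> gives causality, both conditional probabilities being constant.\<close>

lemma causal_independent:
  fixes X Y :: "'a \<Rightarrow> real ^ 'n::{finite,linorder}"
  assumes "prob_space \<pi>" and sp: "space \<pi> = UNIV"
    and X[measurable]: "X \<in> borel_measurable \<pi>" and Y[measurable]: "Y \<in> borel_measurable \<pi>"
    and indep: "\<And>A B. A \<in> sets borel \<Longrightarrow> B \<in> sets borel \<Longrightarrow>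
        measure \<pi> (X -` A \<inter> Y -` B) = measure \<pi> (X -` A) * measure \<pi> (Y -` B)"
  shows "causal \<pi> X Y"
  unfolding causal_def
proof (intro allI ballI)
  fix t :: 'n and A assume A: "A \<in> sets (\<Pi>\<^sub>M s\<in>{..t}. (borel :: real measure))"
  interpret prob_space \<pi> by fact
  define B where "B = {y :: (real, 'n) vec. (\<lambda>s\<in>{..t}. y $ s) \<in> A}"
  have B[measurable]: "B \<in> sets borel"
    unfolding B_def by (rule restricted_path_event_measurable[OF A]) auto
  have eq: "{\<omega>. (\<lambda>s\<in>{..t}. Y \<omega> $ s) \<in> A} = Y -` B" by (auto simp: B_def)
  have YB[measurable]: "Y -` B \<in> sets \<pi>" using measurable_sets[OF Y B] by (simp add: sp)
  have "AE \<omega> in \<pi>. real_cond_exp \<pi> (process_algebra X S) (indicator (Y -` B)) \<omega> = prob (Y -` B)" for S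
  proof -
    have sub: "subalgebra \<pi> (process_algebra X S)" by (intro subalgebra_process_algebra X sp)
    interpret F: sigma_finite_subalgebra \<pi> "process_algebra X S"
      using prob_space_axioms sub by (rule prob_space_subalgebra)
    show ?thesis
    proof (rule F.real_cond_exp_charact)
      fix C assume "C \<in> sets (process_algebra X S)"
      moreover have "sets (process_algebra (\<lambda>x. x) S) \<subseteq> sets (borel :: (real, 'n) vec measure)"
        using subalgebra_process_algebra[of "\<lambda>x. x" "borel :: (real, 'n) vec measure" S]
        by (simp add: subalgebra_def)
      ultimately obtain D where D: "D \<in> sets borel" "C = X -` D"
        by (auto simp: sets_process_algebra_vimage[of X])
      have [measurable]: "C \<in> sets \<pi>" using measurable_sets[OF X D(1)] by (simp add: sp D)
      have "(\<integral>\<omega>\<in>C. indicator (Y -` B) \<omega> \<partial>\<pi>) = (\<integral>\<omega>. indicator (C \<inter> Y -` B) \<omega> \<partial>\<pi>)"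
        by (auto simp: set_lebesgue_integral_def indicator_def intro!: Bochner_Integration.integral_cong)
      also have "\<dots> = prob C * prob (Y -` B)" using indep[OF D(1) B] D by (simp add: sp)
      also have "\<dots> = (\<integral>\<omega>\<in>C. prob (Y -` B) \<partial>\<pi>)" by (simp add: set_lebesgue_integral_def)
      finally show "(\<integral>\<omega>\<in>C. indicator (Y -` B) \<omega> \<partial>\<pi>) = (\<integral>\<omega>\<in>C. prob (Y -` B) \<partial>\<pi>)" .
    qed (auto intro!: integrable_real_indicator simp: less_top[symmetric])
  qed
  from this[of UNIV] this[of "{..t}"] show "AE \<omega> in \<pi>.
      real_cond_exp \<pi> (process_algebra X UNIV) (indicator {\<omega>. (\<lambda>s\<in>{..t}. Y \<omega> $ s) \<in> A}) \<omega>
    = real_cond_exp \<pi> (process_algebra X {..t}) (indicator {\<omega>. (\<lambda>s\<in>{..t}. Y \<omega> $ s) \<in> A}) \<omega>"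
    unfolding eq by eventually_elim simp
qed

text \<open>The product coupling keeps the infimum in the adapted Wasserstein distance from being taken
  over the empty set, where it would have no meaning.\<close>

lemma bicausal_couplings_nonempty:
  fixes P Q :: "(real ^ 'n::{finite,linorder}) measure"
  assumes P: "prob_space P" "sets P = sets borel" and Q: "prob_space Q" "sets Q = sets borel"
  shows "P \<Otimes>\<^sub>M Q \<in> bicausal_couplings P Q"
proof -
  interpret P: prob_space P by fact
  interpret Q: prob_space Q by fact
  interpret PQ: pair_prob_space P Q ..
  have sP: "space P = UNIV" and sQ: "space Q = UNIV"
    using sets_eq_imp_space_eq[OF P(2)] sets_eq_imp_space_eq[OF Q(2)] by auto
  have sets: "sets (P \<Otimes>\<^sub>M Q) = sets borel"
    using sets_pair_measure_cong[OF P(2) Q(2)] by (metis borel_prod)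
  have sp: "space (P \<Otimes>\<^sub>M Q) = UNIV" by (simp add: space_pair_measure sP sQ)
  have f: "fst \<in> borel_measurable (P \<Otimes>\<^sub>M Q)" "snd \<in> borel_measurable (P \<Otimes>\<^sub>M Q)"
    using measurable_fst[of P Q] measurable_snd[of P Q] measurable_cong_sets P Q by blast+
  have m: "measure (P \<Otimes>\<^sub>M Q) (A \<times> B) = measure P A * measure Q B"
    if "A \<in> sets borel" "B \<in> sets borel" for A B
    using that P Q by (simp add: measure_def P.emeasure_pair_measure_Times Q.emeasure_pair_measure_Times enn2real_mult)
  have fst_eq: "fst -` A = A \<times> UNIV" and snd_eq: "snd -` A = UNIV \<times> A" for A :: "(real, 'n) vec set" by auto
  have mP: "measure P UNIV = 1" and mQ: "measure Q UNIV = 1"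
    using P.prob_space Q.prob_space by (simp_all add: sP sQ)
  have "causal (P \<Otimes>\<^sub>M Q) fst snd"
  proof (rule causal_independent[OF PQ.prob_space_axioms sp f])
    fix A B :: "(real, 'n) vec set" assume "A \<in> sets borel" "B \<in> sets borel"
    moreover have "fst -` A \<inter> snd -` B = A \<times> B" by auto
    ultimately show "measure (P \<Otimes>\<^sub>M Q) (fst -` A \<inter> snd -` B)
        = measure (P \<Otimes>\<^sub>M Q) (fst -` A) * measure (P \<Otimes>\<^sub>M Q) (snd -` B)"
      by (simp add: m fst_eq snd_eq mP mQ)
  qed
  moreover have "causal (P \<Otimes>\<^sub>M Q) snd fst"
  proof (rule causal_independent[OF PQ.prob_space_axioms sp f(2,1)])
    fix A B :: "(real, 'n) vec set" assume "A \<in> sets borel" "B \<in> sets borel"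
    moreover have "snd -` A \<inter> fst -` B = B \<times> A" by auto
    ultimately show "measure (P \<Otimes>\<^sub>M Q) (snd -` A \<inter> fst -` B)
        = measure (P \<Otimes>\<^sub>M Q) (snd -` A) * measure (P \<Otimes>\<^sub>M Q) (fst -` B)"
      by (simp add: m fst_eq snd_eq mP mQ)
  qed
  moreover have "distr (P \<Otimes>\<^sub>M Q) borel fst = P" "distr (P \<Otimes>\<^sub>M Q) borel snd = Q"
  proof -
    show "distr (P \<Otimes>\<^sub>M Q) borel fst = P"
    proof (rule measure_eqI)
      fix A assume "A \<in> sets (distr (P \<Otimes>\<^sub>M Q) borel fst)"
      then show "emeasure (distr (P \<Otimes>\<^sub>M Q) borel fst) A = emeasure P A"
        using f P Q.emeasure_space_1 by (simp add: emeasure_distr sp fst_eq Q.emeasure_pair_measure_Times sQ[symmetric])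
    qed (simp add: P)
    show "distr (P \<Otimes>\<^sub>M Q) borel snd = Q"
    proof (rule measure_eqI)
      fix A assume "A \<in> sets (distr (P \<Otimes>\<^sub>M Q) borel snd)"
      then show "emeasure (distr (P \<Otimes>\<^sub>M Q) borel snd) A = emeasure Q A"
        using f Q P.emeasure_space_1 by (simp add: emeasure_distr sp snd_eq Q.emeasure_pair_measure_Times sP[symmetric])
    qed (simp add: Q)
  qed
  ultimately show ?thesis
    by (simp add: bicausal_couplings_def couplings_def sets PQ.prob_space_axioms)
qed

lemma (in prob_space) integrable_of_powr:
  fixes g :: "'a \<Rightarrow> real"
  assumes [measurable]: "g \<in> borel_measurable M"
    and g: "integrable M (\<lambda>x. \<bar>g x\<bar> powr q)" and q: "1 \<le> q"
  shows "integrable M g"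
proof (rule Bochner_Integration.integrable_bound)
  show "integrable M (\<lambda>x. 1 + \<bar>g x\<bar> powr q)" using g by auto
  show "AE x in M. norm (g x) \<le> norm (1 + \<bar>g x\<bar> powr q)"
    by (intro AE_I2) (auto intro: le_one_plus_powr[OF q])
qed simp

text \<open>Conditional expectations stay in \<open>L\<^sup>q\<close>, by the conditional Jensen inequality.\<close>

lemma integrable_real_cond_exp_powr:
  fixes g :: "'a \<Rightarrow> real"
  assumes M: "prob_space M" and F: "subalgebra M F"
    and g: "g \<in> borel_measurable M" "integrable M (\<lambda>x. \<bar>g x\<bar> powr q)" and q: "1 \<le> q"
  shows "integrable M (\<lambda>x. \<bar>real_cond_exp M F g x\<bar> powr q)"
proof -
  interpret prob_space M by fact
  interpret F: sigma_finite_subalgebra M F using M F by (rule prob_space_subalgebra)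
  show ?thesis
    by (rule F.integrable_convex_cond_exp[where I = UNIV and q = "\<lambda>x. \<bar>x\<bar> powr q"])
       (use g q abs_powr_convex in \<open>auto intro: integrable_of_powr\<close>)
qed

text \<open>The conditional expectation of \<open>g(X)\<close> given part of the path \<open>X\<close> is computed under the law
  of \<open>X\<close> on path space.\<close>

lemma real_cond_exp_process_algebra:
  fixes X :: "'a \<Rightarrow> (real ^ 'n::{finite,linorder})"
  assumes "prob_space \<pi>" and sp: "space \<pi> = UNIV" and X[measurable]: "X \<in> borel_measurable \<pi>"
    and g: "integrable (distr \<pi> borel X) g"
  shows "AE \<omega> in \<pi>. real_cond_exp \<pi> (process_algebra X S) (\<lambda>\<omega>. g (X \<omega>)) \<omega>
    = real_cond_exp (distr \<pi> borel X) (process_algebra (\<lambda>x. x) S) g (X \<omega>)"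
proof -
  let ?P = "distr \<pi> borel X" and ?F = "process_algebra (\<lambda>x :: (real, 'n) vec. x) S"
  interpret prob_space \<pi> by fact
  interpret P: prob_space ?P by (rule prob_space_distr) simp
  interpret F: sigma_finite_subalgebra \<pi> "process_algebra X S"
    by (intro prob_space_subalgebra prob_space_axioms subalgebra_process_algebra X sp)
  interpret G: sigma_finite_subalgebra ?P ?F
    by (intro prob_space_subalgebra P.prob_space_axioms subalgebra_process_algebra) auto
  have g_meas[measurable]: "g \<in> borel_measurable borel" using g by auto
  define H where "H = real_cond_exp ?P ?F g"
  have HF: "H \<in> borel_measurable ?F" unfolding H_def by (rule borel_measurable_cond_exp)
  have H_meas[measurable]: "H \<in> borel_measurable borel"
    using borel_measurable_cond_exp2[of ?P ?F g] by (simp add: H_def)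
  have H_int: "integrable ?P H" unfolding H_def using g by (rule G.real_cond_exp_int)
  show ?thesis unfolding H_def[symmetric]
  proof (rule F.real_cond_exp_charact)
    fix A assume "A \<in> sets (process_algebra X S)"
    then obtain B where B: "B \<in> sets ?F" "A = X -` B"
      by (auto simp: sets_process_algebra_vimage[of X])
    have Bb[measurable]: "B \<in> sets borel" using B G.subalg by (auto simp: subalgebra_def)
    have eq: "(\<integral>\<omega>\<in>A. k (X \<omega>) \<partial>\<pi>) = (\<integral>x\<in>B. k x \<partial>?P)"
      if [measurable]: "k \<in> borel_measurable borel" for k :: "(real, 'n) vec \<Rightarrow> real"
      unfolding set_lebesgue_integral_def
      by (subst integral_distr) (auto simp: B indicator_def intro!: Bochner_Integration.integral_cong)
    show "(\<integral>\<omega>\<in>A. g (X \<omega>) \<partial>\<pi>) = (\<integral>\<omega>\<in>A. H (X \<omega>) \<partial>\<pi>)"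
      using G.real_cond_exp_intA[OF g B(1)] by (simp add: eq H_def[symmetric])
  next
    show "integrable \<pi> (\<lambda>\<omega>. g (X \<omega>))" using g by (simp add: integrable_distr_eq)
    show "integrable \<pi> (\<lambda>\<omega>. H (X \<omega>))" using H_int by (simp add: integrable_distr_eq)
    show "(\<lambda>\<omega>. H (X \<omega>)) \<in> borel_measurable (process_algebra X S)"
      using measurable_compose[OF measurable_process_algebra_process HF] .
  qed
qed

text \<open>What causality is used for: against \<open>Y\<^sub>t\<close>, a function of the whole path \<open>X\<close> may be
  replaced by its conditional expectation given \<open>X\<close> up to time \<open>t\<close>. For indicators of \<open>Y\<^sub>t\<close> this
  is the tower property; the general case follows since the difference \<open>D\<close> of the two functions
  of \<open>X\<close> then satisfies \<open>E[D | Y\<^sub>t] = 0\<close>.\<close>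

lemma causal_integral:
  fixes X Y :: "'a \<Rightarrow> real ^ 'n::{finite,linorder}"
  assumes "prob_space \<pi>" and sp: "space \<pi> = UNIV"
    and X[measurable]: "X \<in> borel_measurable \<pi>" and Y[measurable]: "Y \<in> borel_measurable \<pi>"
    and causal: "causal \<pi> X Y" and pq: "conjugate_exponents p q"
    and g: "g \<in> borel_measurable borel" "integrable (distr \<pi> borel X) (\<lambda>x. \<bar>g x\<bar> powr q)"
    and Yt: "integrable \<pi> (\<lambda>\<omega>. \<bar>Y \<omega> $ t\<bar> powr p)"
  shows "(\<integral>\<omega>. g (X \<omega>) * Y \<omega> $ t \<partial>\<pi>)
    = (\<integral>\<omega>. real_cond_exp (distr \<pi> borel X) (process_algebra (\<lambda>x. x) {..t}) g (X \<omega>) * Y \<omega> $ t \<partial>\<pi>)"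
proof -
  let ?P = "distr \<pi> borel X" and ?F = "process_algebra (\<lambda>x :: (real, 'n) vec. x) {..t}"
  let ?X = "process_algebra X UNIV" and ?Xt = "process_algebra X {..t}"
  note pqD = conjugate_exponentsD[OF pq]
  interpret prob_space \<pi> by fact
  interpret P: prob_space ?P by (rule prob_space_distr) simp
  interpret X: sigma_finite_subalgebra \<pi> ?X
    by (intro prob_space_subalgebra prob_space_axioms subalgebra_process_algebra X sp)
  interpret Xt: sigma_finite_subalgebra \<pi> ?Xt
    by (intro prob_space_subalgebra prob_space_axioms subalgebra_process_algebra X sp)
  have subF: "subalgebra ?P ?F" by (intro subalgebra_process_algebra) auto
  define H where "H = real_cond_exp ?P ?F g"
  have [measurable]: "g \<in> borel_measurable borel" by (fact g)
  have HF: "H \<in> borel_measurable ?F" unfolding H_def by (rule borel_measurable_cond_exp)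
  have H_meas[measurable]: "H \<in> borel_measurable borel"
    using borel_measurable_cond_exp2[of ?P ?F g] by (simp add: H_def)
  have g_int: "integrable ?P g" using g pqD(2) by (intro P.integrable_of_powr[of g q]) auto
  have Hq: "integrable ?P (\<lambda>x. \<bar>H x\<bar> powr q)"
    unfolding H_def using g pqD(2) by (intro integrable_real_cond_exp_powr P.prob_space_axioms subF) auto
  have gXq: "integrable \<pi> (\<lambda>\<omega>. \<bar>g (X \<omega>)\<bar> powr q)" and HXq: "integrable \<pi> (\<lambda>\<omega>. \<bar>H (X \<omega>)\<bar> powr q)"
    using g Hq by (simp_all add: integrable_distr_eq)
  have gX: "integrable \<pi> (\<lambda>\<omega>. g (X \<omega>))" and HX: "integrable \<pi> (\<lambda>\<omega>. H (X \<omega>))"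
    using gXq HXq pqD(2) by (auto intro!: integrable_of_powr[of _ q])
  have gXY: "integrable \<pi> (\<lambda>\<omega>. g (X \<omega>) * Y \<omega> $ t)" and HXY: "integrable \<pi> (\<lambda>\<omega>. H (X \<omega>) * Y \<omega> $ t)"
    by (auto intro!: integrable_mult_conjugate[OF pq] gXq HXq Yt)
  have g_X: "(\<lambda>\<omega>. g (X \<omega>)) \<in> borel_measurable ?X"
  proof (rule measurable_compose[OF measurable_process_algebra_process])
    have "(\<lambda>x. x) \<in> borel_measurable (process_algebra (\<lambda>x :: (real, 'n) vec. x) UNIV)"
      by (subst borel_measurable_euclidean_space)
         (auto simp: Basis_vec_def inner_axis intro: measurable_process_algebra_coordinate)
    then show "g \<in> borel_measurable (process_algebra (\<lambda>x. x) UNIV)"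
      by (rule measurable_compose) simp
  qed
  have H_Xt: "(\<lambda>\<omega>. H (X \<omega>)) \<in> borel_measurable ?Xt"
    by (rule measurable_compose[OF measurable_process_algebra_process HF])
  have tower: "(\<integral>\<omega>. g (X \<omega>) * indicator W \<omega> \<partial>\<pi>) = (\<integral>\<omega>. H (X \<omega>) * indicator W \<omega> \<partial>\<pi>)"
    if C: "C \<in> sets borel" and W: "W = {\<omega>. Y \<omega> $ t \<in> C}" for C W
  proof -
    let ?A = "(\<lambda>f. f t) -` C \<inter> space (\<Pi>\<^sub>M s\<in>{..t}. (borel :: real measure))"
    have A: "?A \<in> sets (\<Pi>\<^sub>M s\<in>{..t}. (borel :: real measure))"
      using C by (intro measurable_sets[OF measurable_component_singleton]) auto
    have eq: "{\<omega>. (\<lambda>s\<in>{..t}. Y \<omega> $ s) \<in> ?A} = W" by (auto simp: W space_PiM)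
    have ce: "AE \<omega> in \<pi>. real_cond_exp \<pi> ?X (indicator W) \<omega> = real_cond_exp \<pi> ?Xt (indicator W) \<omega>"
      using causal[unfolded causal_def, rule_format, OF A] by (simp only: eq)
    have [measurable]: "W \<in> sets \<pi>"
      using measurable_sets[of "\<lambda>\<omega>. Y \<omega> $ t" \<pi> borel C] C by (simp add: W sp vimage_def)
    have gW: "integrable \<pi> (\<lambda>\<omega>. g (X \<omega>) * indicator W \<omega>)" and HW: "integrable \<pi> (\<lambda>\<omega>. H (X \<omega>) * indicator W \<omega>)"
      using gX HX by (auto intro: integrable_real_mult_indicator)
    define E where "E = real_cond_exp \<pi> ?X (indicator W)"
    define E' where "E' = real_cond_exp \<pi> ?Xt (indicator W)"
    define G where "G = real_cond_exp \<pi> ?Xt (\<lambda>\<omega>. g (X \<omega>))"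
    have [measurable]: "E \<in> borel_measurable \<pi>" "E' \<in> borel_measurable \<pi>" "G \<in> borel_measurable \<pi>"
      unfolding E_def E'_def G_def by (rule borel_measurable_cond_exp2)+
    have E': "E' \<in> borel_measurable ?Xt" unfolding E'_def by (rule borel_measurable_cond_exp)
    have EE': "AE \<omega> in \<pi>. g (X \<omega>) * E \<omega> = E' \<omega> * g (X \<omega>)"
      using ce by eventually_elim (simp add: E_def E'_def)
    have GH: "AE \<omega> in \<pi>. E' \<omega> * G \<omega> = H (X \<omega>) * E' \<omega>"
      using real_cond_exp_process_algebra[OF prob_space_axioms sp X g_int, of "{..t}"]
      by eventually_elim (simp add: G_def H_def)
    have "(\<integral>\<omega>. g (X \<omega>) * indicator W \<omega> \<partial>\<pi>) = (\<integral>\<omega>. g (X \<omega>) * E \<omega> \<partial>\<pi>)"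
      unfolding E_def by (rule X.real_cond_exp_intg(2)[symmetric]) (fact gW, fact g_X, measurable)
    also have "\<dots> = (\<integral>\<omega>. E' \<omega> * g (X \<omega>) \<partial>\<pi>)"
      by (rule integral_cong_AE) (measurable, fact EE')
    also have "\<dots> = (\<integral>\<omega>. E' \<omega> * G \<omega> \<partial>\<pi>)"
      unfolding G_def
    proof (rule Xt.real_cond_exp_intg(2)[symmetric, OF _ E'])
      have "integrable \<pi> (\<lambda>\<omega>. g (X \<omega>) * E \<omega>)"
        unfolding E_def by (rule X.real_cond_exp_intg(1)) (fact gW, fact g_X, measurable)
      then show "integrable \<pi> (\<lambda>\<omega>. E' \<omega> * g (X \<omega>))"
        by (rule integrable_cong_AE_imp) (measurable, use EE' in \<open>eventually_elim, simp\<close>)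
    qed measurable
    also have "\<dots> = (\<integral>\<omega>. H (X \<omega>) * E' \<omega> \<partial>\<pi>)"
      by (rule integral_cong_AE) (measurable, fact GH)
    also have "\<dots> = (\<integral>\<omega>. H (X \<omega>) * indicator W \<omega> \<partial>\<pi>)"
      unfolding E'_def by (rule Xt.real_cond_exp_intg(2)) (fact HW, fact H_Xt, measurable)
    finally show ?thesis .
  qed
  define D where "D = (\<lambda>\<omega>. g (X \<omega>) - H (X \<omega>))"
  have D_int: "integrable \<pi> D" unfolding D_def using gX HX by auto
  have [measurable]: "D \<in> borel_measurable \<pi>" unfolding D_def by measurable
  let ?Y = "vimage_algebra UNIV (\<lambda>\<omega>. Y \<omega> $ t) (borel :: real measure)"
  have "subalgebra \<pi> ?Y" unfolding subalgebra_def
  proof safe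
    fix W assume "W \<in> sets ?Y"
    then obtain C where "C \<in> sets borel" "W = (\<lambda>\<omega>. Y \<omega> $ t) -` C \<inter> space \<pi>"
      by (auto simp: sets_vimage_algebra2 sp)
    then show "W \<in> sets \<pi>" by (simp add: measurable_sets[OF measurable_vec_nth[OF Y]])
  qed (auto simp: sp)
  then interpret Y: sigma_finite_subalgebra \<pi> ?Y
    by (intro prob_space_subalgebra prob_space_axioms)
  have "AE \<omega> in \<pi>. real_cond_exp \<pi> ?Y D \<omega> = 0"
  proof (rule Y.real_cond_exp_charact)
    fix W assume "W \<in> sets ?Y"
    then obtain C where C: "C \<in> sets borel" "W = {\<omega>. Y \<omega> $ t \<in> C}"
      by (auto simp: sets_vimage_algebra2 vimage_def)
    have [measurable]: "W \<in> sets \<pi>"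
      using measurable_sets[of "\<lambda>\<omega>. Y \<omega> $ t" \<pi> borel C] C by (simp add: sp vimage_def)
    have "(\<integral>\<omega>\<in>W. D \<omega> \<partial>\<pi>) = (\<integral>\<omega>. g (X \<omega>) * indicator W \<omega> - H (X \<omega>) * indicator W \<omega> \<partial>\<pi>)"
      unfolding set_lebesgue_integral_def D_def
      by (intro Bochner_Integration.integral_cong) (auto simp: indicator_def)
    also have "\<dots> = 0" using tower[OF C] gX HX
      by (subst Bochner_Integration.integral_diff) (auto intro: integrable_real_mult_indicator)
    finally show "(\<integral>\<omega>\<in>W. D \<omega> \<partial>\<pi>) = (\<integral>\<omega>\<in>W. 0 \<partial>\<pi>)" by (simp add: set_lebesgue_integral_def)
  qed (use D_int in auto)
  then have "(\<integral>\<omega>. Y \<omega> $ t * real_cond_exp \<pi> ?Y D \<omega> \<partial>\<pi>) = (\<integral>\<omega>. 0 \<partial>\<pi>)"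
    by (intro integral_cong_AE borel_measurable_times borel_measurable_cond_exp2) auto
  moreover have "(\<integral>\<omega>. Y \<omega> $ t * real_cond_exp \<pi> ?Y D \<omega> \<partial>\<pi>) = (\<integral>\<omega>. Y \<omega> $ t * D \<omega> \<partial>\<pi>)"
  proof (rule Y.real_cond_exp_intg(2))
    show "integrable \<pi> (\<lambda>\<omega>. Y \<omega> $ t * D \<omega>)"
      using Bochner_Integration.integrable_diff[OF gXY HXY] by (simp add: D_def algebra_simps)
    show "(\<lambda>\<omega>. Y \<omega> $ t) \<in> borel_measurable ?Y" by (rule measurable_vimage_algebra1) auto
  qed simp
  moreover have "(\<integral>\<omega>. Y \<omega> $ t * D \<omega> \<partial>\<pi>) = (\<integral>\<omega>. g (X \<omega>) * Y \<omega> $ t \<partial>\<pi>) - (\<integral>\<omega>. H (X \<omega>) * Y \<omega> $ t \<partial>\<pi>)"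
    using Bochner_Integration.integral_diff[OF gXY HXY] by (simp add: D_def algebra_simps)
  ultimately show ?thesis by (simp add: H_def)
qed

section \<open>First order expansion over couplings\<close>

text \<open>The vector of partial derivatives.\<close>

definition gradient :: "(real ^ 'n::finite \<Rightarrow> real) \<Rightarrow> real ^ 'n \<Rightarrow> real ^ 'n" where
  "gradient f x = (\<chi> t. partial_deriv t f x)"

lemma gradient_nth [simp]: "gradient f x $ t = partial_deriv t f x"
  by (simp add: gradient_def)

lemma continuously_differentiable_gradient:
  fixes f :: "real ^ 'n::finite \<Rightarrow> real"
  assumes "continuously_differentiable f"
  shows "(f has_derivative (\<lambda>h. gradient f x \<bullet> h)) (at x)" "continuous_on UNIV (gradient f)"
proof -
  obtain f' :: "real ^ 'n \<Rightarrow> (real ^ 'n) \<Rightarrow>\<^sub>L real"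
    where f': "\<And>x. (f has_derivative blinfun_apply (f' x)) (at x)" and cont: "continuous_on UNIV f'"
    using assms unfolding continuously_differentiable_def by blast
  have pd: "partial_deriv t f x = f' x (axis t 1)" for t x
    unfolding partial_deriv_def
  proof (rule DERIV_imp_deriv)
    have "((\<lambda>h. f (x + h *\<^sub>R axis t 1)) has_derivative (\<lambda>h. f' x (h *\<^sub>R axis t 1))) (at 0)"
      by (rule has_derivative_compose[of "\<lambda>h. x + h *\<^sub>R axis t 1" _ _ _ f "blinfun_apply (f' x)"])
         (auto intro!: derivative_eq_intros f')
    then show "((\<lambda>h. f (x + h *\<^sub>R axis t 1)) has_real_derivative f' x (axis t 1)) (at 0)"
      by (rule has_derivative_imp_has_field_derivative) (simp add: blinfun.scaleR_right)
  qed
  have "f' x h = gradient f x \<bullet> h" for x h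
  proof -
    have "f' x h = f' x (\<Sum>t\<in>UNIV. h $ t *\<^sub>R axis t 1)"
      using basis_expansion[of h] by (simp add: scalar_mult_eq_scaleR)
    also have "\<dots> = gradient f x \<bullet> h"
      by (simp add: blinfun.sum_right blinfun.scaleR_right inner_vec_def pd mult.commute)
    finally show ?thesis .
  qed
  then have "blinfun_apply (f' x) = (\<lambda>h. gradient f x \<bullet> h)" for x by auto
  then show "(f has_derivative (\<lambda>h. gradient f x \<bullet> h)) (at x)" using f'[of x] by simp
  show "continuous_on UNIV (gradient f)"
    unfolding gradient_def[abs_def] pd by (intro continuous_intros continuous_on_vec_lambda cont)
qed

text \<open>The error of the first order expansion, with a modulus that separates small increments
  from those at points far out and from large increments. The constant in front of the
  indicator does not depend on the radius \<open>K\<close>.\<close>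

lemma first_order_remainder:
  fixes f :: "'a::euclidean_space \<Rightarrow> real" and G :: "'a \<Rightarrow> 'a"
  assumes der: "\<And>x. (f has_derivative (\<lambda>h. G x \<bullet> h)) (at x)" and cont: "continuous_on UNIV G"
    and p: "1 < p" and C: "0 < C"
    and growth: "\<And>x. norm (G x) \<le> C * (1 + norm x powr (p - 1))"
    and e: "0 < e" and K: "0 < K"
  shows "\<exists>L>0. \<forall>x d. \<bar>f (x + d) - f x - G x \<bullet> d\<bar>
    \<le> norm d * (e + 2 * C * 2 powr (p - 1) * ((1 + norm x powr (p - 1)) * indicator {x. K < norm x} x)
        + L * norm d powr (p - 1))"
proof -
  define A where "A = 2 powr (p - 1)"
  define C0 where "C0 = 2 * C * A"
  have A1: "1 \<le> A" unfolding A_def using p by (intro ge_one_powr_ge_zero) auto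
  have C0: "0 < C0" unfolding C0_def using C A1 by auto
  have "uniformly_continuous_on (cball 0 (K + 1)) G"
    using cont by (intro compact_uniformly_continuous) (auto intro: continuous_on_subset)
  then obtain \<delta>' where \<delta>': "0 < \<delta>'"
    "\<And>x y. x \<in> cball 0 (K + 1) \<Longrightarrow> y \<in> cball 0 (K + 1) \<Longrightarrow> dist y x < \<delta>' \<Longrightarrow> dist (G y) (G x) < e"
    using e unfolding uniformly_continuous_on_def by metis
  define \<delta> where "\<delta> = min 1 \<delta>'"
  have \<delta>: "0 < \<delta>" "\<delta> \<le> 1" "\<delta> \<le> \<delta>'" using \<delta>' by (auto simp: \<delta>_def)
  define L where "L = C0 * ((1 + K powr (p - 1)) / \<delta> powr (p - 1) + 1)"
  have "C0 * 1 \<le> L" unfolding L_def using C0 by (intro mult_left_mono) auto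
  then have L: "C0 \<le> L" "0 < L" using C0 by auto
  have crude: "norm (G (x + \<xi> *\<^sub>R d) - G x) \<le> C0 * (1 + norm x powr (p - 1) + norm d powr (p - 1))"
    if "0 < \<xi>" "\<xi> < 1" for x d \<xi>
  proof -
    have "norm (x + \<xi> *\<^sub>R d) \<le> norm x + norm (\<xi> *\<^sub>R d)" by (rule norm_triangle_ineq)
    also have "\<dots> \<le> norm x + norm d" using that by (simp add: mult_left_le_one_le)
    finally have "norm (x + \<xi> *\<^sub>R d) powr (p - 1) \<le> (norm x + norm d) powr (p - 1)"
      using p by (intro powr_mono2) auto
    also have "\<dots> \<le> A * (norm x powr (p - 1) + norm d powr (p - 1))"
      unfolding A_def using p by (intro add_powr_le) auto
    finally have *: "norm (x + \<xi> *\<^sub>R d) powr (p - 1) \<le> A * (norm x powr (p - 1) + norm d powr (p - 1))" .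
    have "norm (G (x + \<xi> *\<^sub>R d) - G x) \<le> norm (G (x + \<xi> *\<^sub>R d)) + norm (G x)"
      by (rule norm_triangle_ineq4)
    also have "\<dots> \<le> C * (1 + A * (norm x powr (p - 1) + norm d powr (p - 1))) + C * (1 + norm x powr (p - 1))"
    proof (rule add_mono)
      show "norm (G (x + \<xi> *\<^sub>R d)) \<le> C * (1 + A * (norm x powr (p - 1) + norm d powr (p - 1)))"
        using * C by (intro order_trans[OF growth] mult_left_mono) auto
    qed (rule growth)
    also have "\<dots> = C * (2 + (A + 1) * norm x powr (p - 1) + A * norm d powr (p - 1))"
      by (simp add: algebra_simps)
    also have "\<dots> \<le> C * (2 * A + (2 * A) * norm x powr (p - 1) + (2 * A) * norm d powr (p - 1))"
      using C A1 by (intro mult_left_mono add_mono mult_right_mono) auto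
    finally show ?thesis by (simp add: C0_def algebra_simps)
  qed
  have bound: "norm (G (x + \<xi> *\<^sub>R d) - G x)
      \<le> e + C0 * ((1 + norm x powr (p - 1)) * indicator {x. K < norm x} x) + L * norm d powr (p - 1)"
    if \<xi>: "0 < \<xi>" "\<xi> < 1" for x d \<xi>
  proof -
    consider "K < norm x" | "norm x \<le> K" "norm d < \<delta>" | "norm x \<le> K" "\<delta> \<le> norm d" by linarith
    then show ?thesis
    proof cases
      case 1
      have "C0 * norm d powr (p - 1) \<le> L * norm d powr (p - 1)" using L by (intro mult_right_mono) auto
      then show ?thesis using crude[OF \<xi>, of x d] 1 e by (simp add: algebra_simps)
    next
      case 2
      have "norm (\<xi> *\<^sub>R d) \<le> norm d" using \<xi> by (simp add: mult_left_le_one_le)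
      moreover have "norm (x + \<xi> *\<^sub>R d) \<le> norm x + norm (\<xi> *\<^sub>R d)" by (rule norm_triangle_ineq)
      ultimately have "norm (x + \<xi> *\<^sub>R d) \<le> K + 1" "norm (\<xi> *\<^sub>R d) < \<delta>'"
        using 2 \<delta> by linarith+
      then have "dist (G (x + \<xi> *\<^sub>R d)) (G x) < e"
        using 2 by (intro \<delta>') (simp_all only: mem_cball_0 dist_norm add_diff_cancel_left')
      then show ?thesis using L 2 by (simp add: dist_norm add_increasing2)
    next
      case 3
      have "1 \<le> norm d powr (p - 1) / \<delta> powr (p - 1)"
        using 3 \<delta> p by (simp add: powr_mono2)
      then have "(1 + K powr (p - 1)) * 1 \<le> (1 + K powr (p - 1)) * (norm d powr (p - 1) / \<delta> powr (p - 1))"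
        by (intro mult_left_mono) auto
      moreover have "norm x powr (p - 1) \<le> K powr (p - 1)" using 3 p by (intro powr_mono2) auto
      ultimately have "C0 * (1 + norm x powr (p - 1) + norm d powr (p - 1))
          \<le> C0 * ((1 + K powr (p - 1)) * (norm d powr (p - 1) / \<delta> powr (p - 1)) + norm d powr (p - 1))"
        using C0 by (intro mult_left_mono) auto
      also have "\<dots> = L * norm d powr (p - 1)" by (simp add: L_def algebra_simps)
      finally show ?thesis using crude[OF \<xi>, of x d] 3 e by (simp add: algebra_simps)
    qed
  qed
  have "\<bar>f (x + d) - f x - G x \<bullet> d\<bar> \<le> norm d *
    (e + C0 * ((1 + norm x powr (p - 1)) * indicator {x. K < norm x} x) + L * norm d powr (p - 1))" for x d
  proof -
    have "((\<lambda>s. f (x + s *\<^sub>R d)) has_real_derivative G (x + s *\<^sub>R d) \<bullet> d) (at s)" for s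
    proof -
      have "((\<lambda>s. f (x + s *\<^sub>R d)) has_derivative (\<lambda>h. G (x + s *\<^sub>R d) \<bullet> (h *\<^sub>R d))) (at s)"
        by (rule has_derivative_compose[OF _ der]) (auto intro!: derivative_eq_intros)
      then show ?thesis by (rule has_derivative_imp_has_field_derivative) simp
    qed
    then obtain \<xi> where \<xi>: "0 < \<xi>" "\<xi> < 1" "f (x + 1 *\<^sub>R d) - f (x + 0 *\<^sub>R d) = (1 - 0) * (G (x + \<xi> *\<^sub>R d) \<bullet> d)"
      using MVT2[of 0 1 "\<lambda>s. f (x + s *\<^sub>R d)" "\<lambda>s. G (x + s *\<^sub>R d) \<bullet> d"] by auto
    then have "\<bar>f (x + d) - f x - G x \<bullet> d\<bar> = \<bar>(G (x + \<xi> *\<^sub>R d) - G x) \<bullet> d\<bar>"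
      by (simp add: inner_diff_left)
    also have "\<dots> \<le> norm (G (x + \<xi> *\<^sub>R d) - G x) * norm d" by (rule Cauchy_Schwarz_ineq2)
    also have "\<dots> \<le> (e + C0 * ((1 + norm x powr (p - 1)) * indicator {x. K < norm x} x) + L * norm d powr (p - 1)) * norm d"
      by (intro mult_right_mono bound \<xi>) auto
    finally show ?thesis by (simp add: mult.commute)
  qed
  then show ?thesis using L unfolding C0_def A_def by blast
qed

lemma finite_moment_measuresD:
  assumes "P \<in> finite_moment_measures p"
  shows "prob_space P" "sets P = sets borel" "space P = UNIV" "integrable P (\<lambda>x. norm x powr p)"
  using assms sets_eq_imp_space_eq[of P borel] by (auto simp: finite_moment_measures_def)

lemma integrable_norm_finite_moment:
  assumes P: "P \<in> finite_moment_measures p" and p: "1 \<le> p"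
  shows "integrable P norm"
proof (rule Bochner_Integration.integrable_bound)
  note PD = finite_moment_measuresD[OF P]
  interpret prob_space P by (rule PD)
  show "integrable P (\<lambda>x. 1 + norm x powr p)" using PD by auto
  show "norm \<in> borel_measurable P" using PD by (simp cong: measurable_cong_sets)
  show "AE x in P. norm (norm x) \<le> norm (1 + norm x powr p)"
    by (intro AE_I2) (auto intro: le_one_plus_powr[OF p])
qed

lemma integrable_finite_moment:
  fixes f :: "real ^ 'n::finite \<Rightarrow> real"
  assumes der: "\<And>x. (f has_derivative (\<lambda>h. G x \<bullet> h)) (at x)" and cont: "continuous_on UNIV G"
    and p: "1 < p" and C: "0 < C"
    and growth: "\<And>x. norm (G x) \<le> C * (1 + norm x powr (p - 1))"
    and P: "P \<in> finite_moment_measures p"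
  shows "integrable P f"
proof -
  note PD = finite_moment_measuresD[OF P]
  interpret prob_space P by (rule PD)
  obtain L where L: "0 < L" "\<And>x d. \<bar>f (x + d) - f x - G x \<bullet> d\<bar>
    \<le> norm d * (1 + 2 * C * 2 powr (p - 1) * ((1 + norm x powr (p - 1)) * indicator {x. 1 < norm x} x)
        + L * norm d powr (p - 1))"
    using first_order_remainder[OF der cont p C growth zero_less_one zero_less_one] by blast
  let ?b = "\<lambda>x :: real ^ 'n. \<bar>f 0\<bar> + (norm (G 0) + 1) * norm x + L * norm x powr p"
  have b: "integrable P ?b"
    using PD integrable_norm_finite_moment[OF P] p
    by (intro Bochner_Integration.integrable_add integrable_mult_right) auto
  have "continuous_on UNIV f"
    using der by (meson has_derivative_continuous continuous_at_imp_continuous_on)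
  then have f: "f \<in> borel_measurable P"
    using PD by (simp add: borel_measurable_continuous_onI cong: measurable_cong_sets)
  have "\<bar>f x\<bar> \<le> ?b x" for x
  proof -
    have "norm x * norm x powr (p - 1) = norm x powr p"
      using powr_add[of "norm x" 1 "p - 1"] by simp
    then have "\<bar>f x - f 0 - G 0 \<bullet> x\<bar> \<le> norm x + L * norm x powr p"
      using L(2)[of 0 x] by (simp add: algebra_simps)
    moreover have "\<bar>G 0 \<bullet> x\<bar> \<le> norm (G 0) * norm x" by (rule Cauchy_Schwarz_ineq2)
    ultimately show ?thesis by (simp add: algebra_simps)
  qed
  then have "AE x in P. norm (f x) \<le> norm (?b x)"
    by (intro AE_I2) (auto intro: order_trans[OF _ abs_ge_self])
  with b f show ?thesis by (rule Bochner_Integration.integrable_bound)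
qed

lemma couplingsD:
  assumes "\<pi> \<in> couplings P Q"
  shows "prob_space \<pi>" "sets \<pi> = sets borel" "space \<pi> = UNIV"
    "distr \<pi> borel fst = P" "distr \<pi> borel snd = Q"
    "fst \<in> borel_measurable \<pi>" "snd \<in> borel_measurable \<pi>"
proof -
  show *: "prob_space \<pi>" "sets \<pi> = sets borel" "distr \<pi> borel fst = P" "distr \<pi> borel snd = Q"
    using assms by (auto simp: couplings_def)
  show "space \<pi> = UNIV" using sets_eq_imp_space_eq[OF *(2)] by simp
  show "fst \<in> borel_measurable \<pi>" "snd \<in> borel_measurable \<pi>"
    unfolding measurable_cong_sets[OF *(2) refl]
    by (auto intro!: borel_measurable_continuous_onI continuous_intros)
qed

lemma coupling_moments:
  assumes P: "P \<in> finite_moment_measures p" and Q: "Q \<in> finite_moment_measures p"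
    and \<pi>: "\<pi> \<in> couplings P Q" and p: "0 < p"
  shows "integrable \<pi> (\<lambda>\<omega>. norm (snd \<omega> - fst \<omega>) powr p)"
    and "integrable \<pi> (\<lambda>\<omega>. \<bar>snd \<omega> $ t - fst \<omega> $ t\<bar> powr p)"
    and "integrable \<pi> (\<lambda>\<omega>. \<bar>fst \<omega> $ t\<bar> powr p)" "integrable \<pi> (\<lambda>\<omega>. \<bar>snd \<omega> $ t\<bar> powr p)"
proof -
  note \<pi>D = couplingsD[OF \<pi>]
  note [measurable] = \<pi>D(6,7)
  have 1: "integrable \<pi> (\<lambda>\<omega>. norm (fst \<omega>) powr p)"
    using finite_moment_measuresD(4)[OF P] unfolding \<pi>D(4)[symmetric] by (simp add: integrable_distr_eq)
  have 2: "integrable \<pi> (\<lambda>\<omega>. norm (snd \<omega>) powr p)"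
    using finite_moment_measuresD(4)[OF Q] unfolding \<pi>D(5)[symmetric] by (simp add: integrable_distr_eq)
  show D: "integrable \<pi> (\<lambda>\<omega>. norm (snd \<omega> - fst \<omega>) powr p)"
  proof (rule Bochner_Integration.integrable_bound)
    show "integrable \<pi> (\<lambda>\<omega>. 2 powr p * (norm (snd \<omega>) powr p + norm (fst \<omega>) powr p))" using 1 2 by auto
    have "norm (y - x) powr p \<le> 2 powr p * (norm y powr p + norm x powr p)" for x y :: "(real, 'a) vec"
      using p by (intro order_trans[OF powr_mono2 add_powr_le]) (auto intro: norm_triangle_ineq4)
    then show "AE \<omega> in \<pi>. norm (norm (snd \<omega> - fst \<omega>) powr p)
        \<le> norm (2 powr p * (norm (snd \<omega>) powr p + norm (fst \<omega>) powr p))"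
      by (intro AE_I2) auto
  qed measurable
  have comp: "integrable \<pi> (\<lambda>\<omega>. \<bar>Z \<omega> $ t\<bar> powr p)"
    if "integrable \<pi> (\<lambda>\<omega>. norm (Z \<omega>) powr p)" and [measurable]: "Z \<in> borel_measurable \<pi>"
    for Z :: "_ \<Rightarrow> (real, 'a) vec"
    by (rule Bochner_Integration.integrable_bound[OF that(1)])
       (use p in \<open>auto intro!: powr_mono2 component_le_norm_cart\<close>)
  show "integrable \<pi> (\<lambda>\<omega>. \<bar>snd \<omega> $ t - fst \<omega> $ t\<bar> powr p)" using comp[OF D] by simp
  show "integrable \<pi> (\<lambda>\<omega>. \<bar>fst \<omega> $ t\<bar> powr p)" "integrable \<pi> (\<lambda>\<omega>. \<bar>snd \<omega> $ t\<bar> powr p)"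
    using comp[OF 1] comp[OF 2] by simp_all
qed

text \<open>Growth of order \<open>p - 1\<close> turns into growth of order \<open>p\<close> for the \<open>q\<close>-th power.\<close>

lemma growth_powr_conjugate:
  fixes C y u p q :: real
  assumes pq: "conjugate_exponents p q" and y: "0 \<le> y" and u: "0 \<le> u" "u \<le> C * (1 + y powr (p - 1))" and C: "0 \<le> C"
  shows "u powr q \<le> C powr q * 2 powr q * (1 + y powr p)"
proof -
  note pqD = conjugate_exponentsD[OF pq]
  have "u powr q \<le> (C * (1 + y powr (p - 1))) powr q" using u pqD(1,2) by (intro powr_mono2) auto
  also have "\<dots> = C powr q * (1 + y powr (p - 1)) powr q" using C by (simp add: powr_mult)
  also have "\<dots> \<le> C powr q * (2 powr q * (1 powr q + (y powr (p - 1)) powr q))"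
    using pqD(1,2) by (intro mult_left_mono add_powr_le) auto
  also have "(y powr (p - 1)) powr q = y powr p" using pqD(3) by (simp add: powr_powr)
  finally show ?thesis by (simp add: mult.assoc)
qed

text \<open>The \<open>L\<^sup>q\<close> norm of the growth bound outside a large ball is small; only the \<open>p\<close>-th moment of
  \<open>P\<close> enters.\<close>

lemma tail_growth_small:
  fixes P :: "(real ^ 'n::finite) measure"
  assumes pq: "conjugate_exponents p q" and P: "P \<in> finite_moment_measures p" and \<eta>: "0 < \<eta>"
  defines "w \<equiv> \<lambda>K x. (1 + norm x powr (p - 1)) * indicator {x. K < norm x} x"
  shows "\<exists>K>0. integrable P (\<lambda>x. \<bar>w K x\<bar> powr q) \<and> (\<integral>x. \<bar>w K x\<bar> powr q \<partial>P) \<le> \<eta>"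
proof -
  note PD = finite_moment_measuresD[OF P] and pqD = conjugate_exponentsD[OF pq]
  interpret prob_space P by (rule PD)
  note [measurable_cong] = PD(2)
  have [measurable]: "w K \<in> borel_measurable P" for K unfolding w_def by measurable
  let ?d = "\<lambda>x :: (real, 'n) vec. 2 powr q * (1 + norm x powr p)"
  have d: "integrable P ?d" using PD by auto
  have le: "\<bar>w K x\<bar> powr q \<le> ?d x" for K x
    using growth_powr_conjugate[OF pq, of "norm x" "\<bar>w K x\<bar>" 1] by (auto simp: w_def indicator_def)
  have lim: "(\<lambda>n. \<bar>w (real n) x\<bar> powr q) \<longlonglongrightarrow> 0" for x
  proof (rule tendsto_eventually)
    show "\<forall>\<^sub>F n in sequentially. \<bar>w (real n) x\<bar> powr q = 0"
      using eventually_ge_at_top[of "nat \<lceil>norm x\<rceil>"]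
    proof eventually_elim
      case (elim n)
      then have "norm x \<le> real n" by linarith
      then show ?case by (simp add: w_def)
    qed
  qed
  have int: "integrable P (\<lambda>x. \<bar>w K x\<bar> powr q)" for K
    by (rule Bochner_Integration.integrable_bound[OF d]) (use le in \<open>auto intro: order_trans[OF _ abs_ge_self]\<close>)
  have "(\<lambda>n. \<integral>x. \<bar>w (real n) x\<bar> powr q \<partial>P) \<longlonglongrightarrow> (\<integral>x. 0 \<partial>P)"
    by (rule integral_dominated_convergence[OF _ _ d]) (use lim le in auto)
  then have "\<forall>\<^sub>F n in sequentially. (\<integral>x. \<bar>w (real n) x\<bar> powr q \<partial>P) < \<eta>"
    using \<eta> by (auto dest!: order_tendstoD(2))
  then have "\<forall>\<^sub>F n in sequentially. (\<integral>x. \<bar>w (real n) x\<bar> powr q \<partial>P) < \<eta> \<and> 0 < real n"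
    using eventually_gt_at_top[of 0] by eventually_elim auto
  then obtain n where "(\<integral>x. \<bar>w (real n) x\<bar> powr q \<partial>P) < \<eta>" "0 < real n"
    using eventually_happens by force
  then show ?thesis using int by (intro exI[of _ "real n"]) auto
qed

text \<open>The first order expansion of \<open>E\<^sub>Q f\<close> around \<open>E\<^sub>P f\<close>, with an error that is uniform over all
  \<open>Q\<close> and all couplings, causal or not, of transport cost at most \<open>r\<close>. The pointwise remainder is
  integrated term by term: Hoelder's inequality makes its first two terms small multiples of \<open>r\<close>,
  and the last one is of order \<open>r\<^sup>p\<close>.\<close>

proposition first_order_expansion:
  fixes P :: "(real ^ 'n::{finite,linorder}) measure"
  assumes der: "\<And>x. (f has_derivative (\<lambda>h. G x \<bullet> h)) (at x)" and cont: "continuous_on UNIV G"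
    and pq: "conjugate_exponents p q" and C: "0 < C"
    and growth: "\<And>x. norm (G x) \<le> C * (1 + norm x powr (p - 1))"
    and P: "P \<in> finite_moment_measures p" and e: "0 < e"
  shows "\<exists>r0>0. \<forall>Q\<in>finite_moment_measures p. \<forall>\<pi>\<in>couplings P Q. \<forall>r. 0 < r \<longrightarrow> r < r0 \<longrightarrow>
    (\<Sum>t\<in>UNIV. \<integral>\<omega>. \<bar>fst \<omega> $ t - snd \<omega> $ t\<bar> powr p \<partial>\<pi>) \<le> r powr p \<longrightarrow>
    \<bar>(\<integral>x. f x \<partial>Q) - (\<integral>x. f x \<partial>P) - (\<Sum>t\<in>UNIV. \<integral>\<omega>. G (fst \<omega>) $ t * (snd \<omega> $ t - fst \<omega> $ t) \<partial>\<pi>)\<bar> \<le> e * r"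
proof -
  note pqD = conjugate_exponentsD[OF pq]
  define n where "n = real CARD('n)"
  define C0 where "C0 = 2 * C * 2 powr (p - 1)"
  define \<eta> where "\<eta> = e / (3 * n * C0)"
  have n: "0 < n" and C0: "0 < C0" using C by (auto simp: n_def C0_def)
  then have \<eta>: "0 < \<eta>" using e by (auto simp: \<eta>_def)
  define w :: "real \<Rightarrow> (real, 'n) vec \<Rightarrow> real"
    where "w = (\<lambda>K x. (1 + norm x powr (p - 1)) * indicator {x. K < norm x} x)"
  obtain K where K: "0 < K" "integrable P (\<lambda>x. \<bar>w K x\<bar> powr q)" "(\<integral>x. \<bar>w K x\<bar> powr q \<partial>P) \<le> \<eta> powr q"
    using tail_growth_small[OF pq P, of "\<eta> powr q"] \<eta> unfolding w_def by auto
  have "0 < e / (3 * n)" using e n by simp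
  then obtain L where L: "0 < L" "\<And>x d. \<bar>f (x + d) - f x - G x \<bullet> d\<bar>
      \<le> norm d * (e / (3 * n) + C0 * w K x + L * norm d powr (p - 1))"
    using first_order_remainder[OF der cont pqD(1) C growth _ K(1)] unfolding w_def C0_def by blast
  \<comment> \<open>The choice that makes the contribution \<open>L (n r)\<^sup>p\<close> at most \<open>e r / 3\<close> for \<open>r < r0\<close>.\<close>
  define r0 where "r0 = (e / (3 * L * n powr p)) powr (1 / (p - 1))"
  have r0: "0 < r0" using e L n by (simp add: r0_def)
  have w_meas[measurable]: "w K \<in> borel_measurable borel" unfolding w_def by measurable
  have w0: "0 \<le> w K x" for x unfolding w_def by (auto simp: indicator_def)
  have "\<bar>(\<integral>x. f x \<partial>Q) - (\<integral>x. f x \<partial>P) - (\<Sum>t\<in>UNIV. \<integral>\<omega>. G (fst \<omega>) $ t * (snd \<omega> $ t - fst \<omega> $ t) \<partial>\<pi>)\<bar> \<le> e * r"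
    if Q: "Q \<in> finite_moment_measures p" and \<pi>: "\<pi> \<in> couplings P Q" and r: "0 < r" "r < r0"
      and cost: "(\<Sum>t\<in>UNIV. \<integral>\<omega>. \<bar>fst \<omega> $ t - snd \<omega> $ t\<bar> powr p \<partial>\<pi>) \<le> r powr p" for Q \<pi> r
  proof -
    note \<pi>D = couplingsD[OF \<pi>] and mom = coupling_moments[OF P Q \<pi>]
    interpret prob_space \<pi> by (rule \<pi>D)
    have X[measurable]: "fst \<in> borel_measurable \<pi>" and Y[measurable]: "snd \<in> borel_measurable \<pi>" by (rule \<pi>D)+
    have [measurable]: "G \<in> borel_measurable borel" using cont by (rule borel_measurable_continuous_onI)
    have "continuous_on UNIV f"
      using der by (meson has_derivative_continuous continuous_at_imp_continuous_on)
    then have [measurable]: "f \<in> borel_measurable borel" by (rule borel_measurable_continuous_onI)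
    define D where "D = (\<lambda>\<omega> :: (real, 'n) vec \<times> (real, 'n) vec. snd \<omega> - fst \<omega>)"
    have [measurable]: "D \<in> borel_measurable \<pi>" unfolding D_def by measurable
    have Dp: "integrable \<pi> (\<lambda>\<omega>. norm (D \<omega>) powr p)" "\<And>t. integrable \<pi> (\<lambda>\<omega>. \<bar>D \<omega> $ t\<bar> powr p)"
      unfolding D_def using mom pqD(1,2) by auto
    have D_norm: "(\<integral>\<omega>. norm (D \<omega>) powr p \<partial>\<pi>) \<le> (n * r) powr p"
    proof -
      have "(\<integral>\<omega>. norm (D \<omega>) powr p \<partial>\<pi>) \<le> (\<integral>\<omega>. n powr p * (\<Sum>t\<in>UNIV. \<bar>D \<omega> $ t\<bar> powr p) \<partial>\<pi>)"
        unfolding n_def using Dp pqD(1,2)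
        by (intro integral_mono integrable_mult_right Bochner_Integration.integrable_sum norm_powr_le_sum) auto
      also have "\<dots> = n powr p * (\<Sum>t\<in>UNIV. \<integral>\<omega>. \<bar>fst \<omega> $ t - snd \<omega> $ t\<bar> powr p \<partial>\<pi>)"
        using Dp by (simp add: D_def abs_minus_commute)
      also have "\<dots> \<le> n powr p * r powr p" using cost by (intro mult_left_mono) auto
      finally show ?thesis using n r by (simp add: powr_mult)
    qed
    have D1: "integrable \<pi> (\<lambda>\<omega>. norm (D \<omega>))" by (rule integrable_of_powr[of _ p]) (use Dp pqD(1) in auto)
    have D1_le: "(\<integral>\<omega>. norm (D \<omega>) \<partial>\<pi>) \<le> n * r"
      using Hoelder_sum_integral[OF pq, of "{()}" "\<lambda>_ _. 1" \<pi> "\<lambda>_ \<omega>. norm (D \<omega>)" 1 "n * r"] Dp D_norm n r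
      by (simp add: prob_space)
    have wq: "integrable \<pi> (\<lambda>\<omega>. \<bar>w K (fst \<omega>)\<bar> powr q)" "(\<integral>\<omega>. \<bar>w K (fst \<omega>)\<bar> powr q \<partial>\<pi>) \<le> \<eta> powr q"
      using K unfolding \<pi>D(4)[symmetric] by (simp_all add: integrable_distr_eq integral_distr)
    have wD: "integrable \<pi> (\<lambda>\<omega>. w K (fst \<omega>) * norm (D \<omega>))"
      using wq Dp by (intro integrable_mult_conjugate[OF pq]) auto
    have wD_le: "(\<integral>\<omega>. w K (fst \<omega>) * norm (D \<omega>) \<partial>\<pi>) \<le> \<eta> * (n * r)"
      using Hoelder_sum_integral[OF pq, of "{()}" "\<lambda>_ \<omega>. w K (fst \<omega>)" \<pi> "\<lambda>_ \<omega>. norm (D \<omega>)" \<eta> "n * r"]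
        Dp D_norm n r wq \<eta> w0 by (simp add: abs_mult)
    have "integrable P f" "integrable Q f"
      using integrable_finite_moment[OF der cont pqD(1) C growth] P Q by auto
    then have fX: "integrable \<pi> (\<lambda>\<omega>. f (fst \<omega>))" and fY: "integrable \<pi> (\<lambda>\<omega>. f (snd \<omega>))"
      unfolding \<pi>D(4,5)[symmetric] by (simp_all add: integrable_distr_eq)
    have fXe: "(\<integral>x. f x \<partial>P) = (\<integral>\<omega>. f (fst \<omega>) \<partial>\<pi>)" and fYe: "(\<integral>x. f x \<partial>Q) = (\<integral>\<omega>. f (snd \<omega>) \<partial>\<pi>)"
      unfolding \<pi>D(4,5)[symmetric] by (simp_all add: integral_distr)
    have Gq: "integrable \<pi> (\<lambda>\<omega>. \<bar>G (fst \<omega>) $ t\<bar> powr q)" for t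
    proof -
      have "integrable P (\<lambda>x. \<bar>G x $ t\<bar> powr q)"
      proof (rule Bochner_Integration.integrable_bound)
        interpret P: prob_space P using P by (rule finite_moment_measuresD)
        show "integrable P (\<lambda>x. C powr q * 2 powr q * (1 + norm x powr p))"
          using finite_moment_measuresD(4)[OF P] by auto
        show "(\<lambda>x. \<bar>G x $ t\<bar> powr q) \<in> borel_measurable P"
          using finite_moment_measuresD(2)[OF P] by (simp cong: measurable_cong_sets)
        have "\<bar>G x $ t\<bar> powr q \<le> C powr q * 2 powr q * (1 + norm x powr p)" for x
          using C by (intro growth_powr_conjugate[OF pq])
            (auto intro: order_trans[OF component_le_norm_cart growth])
        then show "AE x in P. norm (\<bar>G x $ t\<bar> powr q) \<le> norm (C powr q * 2 powr q * (1 + norm x powr p))"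
          by (intro AE_I2) (auto intro: order_trans[OF _ abs_ge_self])
      qed
      then show ?thesis unfolding \<pi>D(4)[symmetric] by (simp add: integrable_distr_eq)
    qed
    have GD: "integrable \<pi> (\<lambda>\<omega>. G (fst \<omega>) $ t * D \<omega> $ t)" for t
      using Gq Dp by (intro integrable_mult_conjugate[OF pq]) auto
    have GD_sum: "(\<Sum>t\<in>UNIV. \<integral>\<omega>. G (fst \<omega>) $ t * (snd \<omega> $ t - fst \<omega> $ t) \<partial>\<pi>) = (\<integral>\<omega>. G (fst \<omega>) \<bullet> D \<omega> \<partial>\<pi>)"
      using GD by (simp add: inner_vec_def D_def)
    have GD_int: "integrable \<pi> (\<lambda>\<omega>. G (fst \<omega>) \<bullet> D \<omega>)"
      unfolding inner_vec_def using GD by auto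
    let ?R = "\<lambda>\<omega>. e / (3 * n) * norm (D \<omega>) + C0 * (w K (fst \<omega>) * norm (D \<omega>)) + L * norm (D \<omega>) powr p"
    have R_int: "integrable \<pi> ?R" using D1 wD Dp by auto
    have pw: "\<bar>f (snd \<omega>) - f (fst \<omega>) - G (fst \<omega>) \<bullet> D \<omega>\<bar> \<le> ?R \<omega>" for \<omega>
    proof -
      have "norm (D \<omega>) * norm (D \<omega>) powr (p - 1) = norm (D \<omega>) powr p"
        using powr_add[of "norm (D \<omega>)" 1 "p - 1"] by simp
      then show ?thesis using L(2)[of "fst \<omega>" "D \<omega>"] by (simp add: D_def algebra_simps)
    qed
    have "\<bar>(\<integral>\<omega>. f (snd \<omega>) \<partial>\<pi>) - (\<integral>\<omega>. f (fst \<omega>) \<partial>\<pi>) - (\<integral>\<omega>. G (fst \<omega>) \<bullet> D \<omega> \<partial>\<pi>)\<bar>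
        = \<bar>\<integral>\<omega>. f (snd \<omega>) - f (fst \<omega>) - G (fst \<omega>) \<bullet> D \<omega> \<partial>\<pi>\<bar>"
      using fX fY GD_int by simp
    also have "\<dots> \<le> (\<integral>\<omega>. ?R \<omega> \<partial>\<pi>)"
      by (rule order_trans[OF integral_abs_bound])
         (intro integral_mono integrable_abs Bochner_Integration.integrable_diff fX fY GD_int R_int pw)
    also have "\<dots> = e / (3 * n) * (\<integral>\<omega>. norm (D \<omega>) \<partial>\<pi>) + C0 * (\<integral>\<omega>. w K (fst \<omega>) * norm (D \<omega>) \<partial>\<pi>)
        + L * (\<integral>\<omega>. norm (D \<omega>) powr p \<partial>\<pi>)"
      using D1 wD Dp by simp
    also have "\<dots> \<le> e / (3 * n) * (n * r) + C0 * (\<eta> * (n * r)) + L * (n * r) powr p"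
      using D1_le wD_le D_norm L C0 e n by (intro add_mono mult_left_mono) auto
    also have "L * (n * r) powr p \<le> e / 3 * r"
    proof -
      have "r powr (p - 1) \<le> r0 powr (p - 1)" using r pqD(1,2) by (intro powr_mono2) auto
      also have "\<dots> = e / (3 * L * n powr p)" using e L n pqD(1,2) by (simp add: r0_def powr_powr)
      finally have "L * n powr p * r powr (p - 1) \<le> e / 3" using L n by (simp add: field_simps)
      then have "L * n powr p * r powr (p - 1) * r \<le> e / 3 * r" using r by (intro mult_right_mono) auto
      moreover have "r powr p = r powr (p - 1) * r" using powr_add[of r "p - 1" 1] r by simp
      ultimately show ?thesis using n r by (simp add: powr_mult mult.assoc)
    qed
    also have "e / (3 * n) * (n * r) + C0 * (\<eta> * (n * r)) + e / 3 * r = e * r"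
      using n C0 by (simp add: \<eta>_def field_simps)
    finally show ?thesis unfolding fXe fYe GD_sum by simp
  qed
  then show ?thesis using r0 by blast
qed

section \<open>Density of Lipschitz functions of the past\<close>

text \<open>Bounded Lipschitz functions of the coordinates in \<open>S\<close>.\<close>

definition test_functions :: "'n set \<Rightarrow> (real ^ 'n::finite \<Rightarrow> real) set" where
  "test_functions S = {\<phi>. (\<exists>B. \<forall>x. \<bar>\<phi> x\<bar> \<le> B) \<and> (\<exists>L. \<forall>x y. \<bar>\<phi> x - \<phi> y\<bar> \<le> L * norm (x - y)) \<and>
     (\<forall>x y. (\<forall>s\<in>S. x $ s = y $ s) \<longrightarrow> \<phi> x = \<phi> y)}"

lemma test_functions_bounded: "\<phi> \<in> test_functions S \<Longrightarrow> \<exists>B. \<forall>x. \<bar>\<phi> x\<bar> \<le> B"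
  by (simp add: test_functions_def)

lemma test_functions_lipschitz:
  assumes "\<phi> \<in> test_functions S"
  shows "\<exists>L\<ge>0. \<forall>x y. \<bar>\<phi> x - \<phi> y\<bar> \<le> L * norm (x - y)"
proof -
  obtain L where L: "\<And>x y. \<bar>\<phi> x - \<phi> y\<bar> \<le> L * norm (x - y)"
    using assms unfolding test_functions_def by blast
  have "\<bar>\<phi> x - \<phi> y\<bar> \<le> \<bar>L\<bar> * norm (x - y)" for x y
    by (rule order_trans[OF L mult_right_mono]) auto
  then show ?thesis by (intro exI[of _ "\<bar>L\<bar>"]) simp
qed

lemma test_functions_cong:
  assumes "\<phi> \<in> test_functions S" "\<And>s. s \<in> S \<Longrightarrow> x $ s = y $ s"
  shows "\<phi> x = \<phi> y"
  using assms unfolding test_functions_def by blast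

lemma test_functionsI:
  assumes "\<And>x. \<bar>\<phi> x\<bar> \<le> B" "\<And>x y. \<bar>\<phi> x - \<phi> y\<bar> \<le> L * norm (x - y)"
    "\<And>x y. (\<And>s. s \<in> S \<Longrightarrow> x $ s = y $ s) \<Longrightarrow> \<phi> x = \<phi> y"
  shows "\<phi> \<in> test_functions S"
  using assms unfolding test_functions_def by blast

lemma test_functions_continuous:
  assumes "\<phi> \<in> test_functions S"
  shows "continuous_on UNIV \<phi>"
proof -
  obtain L where L: "0 \<le> L" "\<And>x y. \<bar>\<phi> x - \<phi> y\<bar> \<le> L * norm (x - y)"
    using test_functions_lipschitz[OF assms] by blast
  then have "L-lipschitz_on UNIV \<phi>" by (intro lipschitz_onI) (auto simp: dist_norm)
  then show ?thesis by (rule lipschitz_on_continuous_on)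
qed

lemma test_functions_measurable:
  "\<phi> \<in> test_functions S \<Longrightarrow> \<phi> \<in> borel_measurable borel"
  by (intro borel_measurable_continuous_onI test_functions_continuous)

lemma test_functions_const: "(\<lambda>x. c) \<in> test_functions S"
  by (rule test_functionsI[of _ "\<bar>c\<bar>" 0]) auto

text \<open>Closure under Lipschitz operations \<open>h\<close> on pairs of values.\<close>

lemma test_functions_combine:
  assumes \<phi>: "\<phi> \<in> test_functions S" and \<psi>: "\<psi> \<in> test_functions S"
    and h: "\<And>a b. \<bar>h a b\<bar> \<le> H * (1 + \<bar>a\<bar> + \<bar>b\<bar>)"
      "\<And>a b a' b'. \<bar>h a b - h a' b'\<bar> \<le> H * (\<bar>a - a'\<bar> + \<bar>b - b'\<bar>)" and H: "0 \<le> H"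
  shows "(\<lambda>x. h (\<phi> x) (\<psi> x)) \<in> test_functions S"
proof -
  obtain B where B: "\<And>x. \<bar>\<phi> x\<bar> \<le> B" using test_functions_bounded[OF \<phi>] by blast
  obtain B' where B': "\<And>x. \<bar>\<psi> x\<bar> \<le> B'" using test_functions_bounded[OF \<psi>] by blast
  obtain L where L: "\<And>x y. \<bar>\<phi> x - \<phi> y\<bar> \<le> L * norm (x - y)" using test_functions_lipschitz[OF \<phi>] by blast
  obtain L' where L': "\<And>x y. \<bar>\<psi> x - \<psi> y\<bar> \<le> L' * norm (x - y)" using test_functions_lipschitz[OF \<psi>] by blast
  show ?thesis
  proof (rule test_functionsI[of _ "H * (1 + B + B')" "H * (L + L')"])
    fix x y
    show "\<bar>h (\<phi> x) (\<psi> x)\<bar> \<le> H * (1 + B + B')"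
      using B[of x] B'[of x] H by (intro order_trans[OF h(1)] mult_left_mono) auto
    have "\<bar>h (\<phi> x) (\<psi> x) - h (\<phi> y) (\<psi> y)\<bar> \<le> H * (\<bar>\<phi> x - \<phi> y\<bar> + \<bar>\<psi> x - \<psi> y\<bar>)" by (rule h(2))
    also have "\<dots> \<le> H * (L * norm (x - y) + L' * norm (x - y))"
      using H by (intro mult_left_mono add_mono L L')
    finally show "\<bar>h (\<phi> x) (\<psi> x) - h (\<phi> y) (\<psi> y)\<bar> \<le> H * (L + L') * norm (x - y)"
      by (simp add: algebra_simps)
  next
    fix x y :: "real ^ 'a" assume "\<And>s. s \<in> S \<Longrightarrow> x $ s = y $ s"
    then show "h (\<phi> x) (\<psi> x) = h (\<phi> y) (\<psi> y)"
      using test_functions_cong[OF \<phi>] test_functions_cong[OF \<psi>] by metis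
  qed
qed

lemma test_functions_add:
  "\<phi> \<in> test_functions S \<Longrightarrow> \<psi> \<in> test_functions S \<Longrightarrow> (\<lambda>x. \<phi> x + \<psi> x) \<in> test_functions S"
  by (rule test_functions_combine[where H = 1]) auto

lemma test_functions_max:
  "\<phi> \<in> test_functions S \<Longrightarrow> \<psi> \<in> test_functions S \<Longrightarrow> (\<lambda>x. max (\<phi> x) (\<psi> x)) \<in> test_functions S"
  by (rule test_functions_combine[where H = 1]) (auto simp: max_def)

lemma test_functions_cmult:
  assumes "\<phi> \<in> test_functions S"
  shows "(\<lambda>x. c * \<phi> x) \<in> test_functions S"
proof (rule test_functions_combine[where H = "\<bar>c\<bar>" and h = "\<lambda>a b. c * a", OF assms assms])
  fix a b a' b' :: real
  show "\<bar>c * a\<bar> \<le> \<bar>c\<bar> * (1 + \<bar>a\<bar> + \<bar>b\<bar>)" by (simp add: abs_mult mult_left_mono)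
  show "\<bar>c * a - c * a'\<bar> \<le> \<bar>c\<bar> * (\<bar>a - a'\<bar> + \<bar>b - b'\<bar>)"
    by (simp add: abs_mult mult_left_mono flip: right_diff_distrib)
qed simp

text \<open>Borel sets whose indicator is an \<open>L\<^sup>1(P)\<close> limit of test functions with values in \<open>[0, 1]\<close>. They
  form a \<open>\<sigma>\<close>-algebra that contains the half spaces in the directions \<open>S\<close>, hence all of
  \<open>\<sigma>(X\<^sub>s : s \<in> S)\<close>.\<close>

definition approximable_set :: "(real ^ 'n::finite) measure \<Rightarrow> 'n set \<Rightarrow> (real ^ 'n) set \<Rightarrow> bool" where
  "approximable_set P S A \<longleftrightarrow> A \<in> sets borel \<and>
     (\<forall>e>0. \<exists>\<phi>\<in>test_functions S. (\<forall>x. 0 \<le> \<phi> x \<and> \<phi> x \<le> 1) \<and> (\<integral>x. \<bar>indicator A x - \<phi> x\<bar> \<partial>P) \<le> e)"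

context
  fixes P :: "(real ^ 'n::finite) measure" and S :: "'n set"
  assumes P: "prob_space P" and sets_P: "sets P = sets borel"
begin

interpretation prob_space P by (rule P)

lemma test_functions_measurable_P: "\<phi> \<in> test_functions S \<Longrightarrow> \<phi> \<in> borel_measurable P"
  using test_functions_measurable[of \<phi> S] by (simp add: sets_P cong: measurable_cong_sets)

lemma indicator_error_integrable:
  assumes "A \<in> sets borel" "\<phi> \<in> test_functions S"
  shows "integrable P (\<lambda>x. \<bar>indicator A x - \<phi> x\<bar>)"
proof -
  obtain B where B: "\<And>x. \<bar>\<phi> x\<bar> \<le> B" using test_functions_bounded[OF assms(2)] by blast
  have [measurable]: "A \<in> sets P" "\<phi> \<in> borel_measurable P"
    using assms test_functions_measurable_P by (auto simp: sets_P)
  have "\<bar>indicator A x - \<phi> x\<bar> \<le> 1 + B" for x using B[of x] by (auto simp: indicator_def)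
  then show ?thesis by (intro integrable_const_bound[where B = "1 + B"]) auto
qed

lemma approximable_set_Compl:
  assumes A: "approximable_set P S A"
  shows "approximable_set P S (UNIV - A)"
  unfolding approximable_set_def
proof (intro conjI allI impI)
  show "UNIV - A \<in> sets borel" using A by (auto simp: approximable_set_def)
  fix e :: real assume "0 < e"
  then obtain \<phi> where \<phi>: "\<phi> \<in> test_functions S" "\<And>x. 0 \<le> \<phi> x \<and> \<phi> x \<le> 1" "(\<integral>x. \<bar>indicator A x - \<phi> x\<bar> \<partial>P) \<le> e"
    using A unfolding approximable_set_def by blast
  have "(\<lambda>x. 1 + (- 1) * \<phi> x) \<in> test_functions S"
    by (intro test_functions_add test_functions_const test_functions_cmult \<phi>)
  moreover have "\<bar>indicator (UNIV - A) x - (1 + (- 1) * \<phi> x)\<bar> = \<bar>indicator A x - \<phi> x\<bar>" for x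
    by (auto simp: indicator_def)
  ultimately show "\<exists>\<phi>\<in>test_functions S. (\<forall>x. 0 \<le> \<phi> x \<and> \<phi> x \<le> 1) \<and> (\<integral>x. \<bar>indicator (UNIV - A) x - \<phi> x\<bar> \<partial>P) \<le> e"
    using \<phi> by (intro bexI[of _ "\<lambda>x. 1 + (- 1) * \<phi> x"]) auto
qed

lemma approximable_set_empty: "approximable_set P S {}"
  unfolding approximable_set_def
  by (auto intro!: bexI[of _ "\<lambda>x. 0"] test_functions_const)

lemma approximable_set_Un:
  assumes A: "approximable_set P S A" and B: "approximable_set P S B"
  shows "approximable_set P S (A \<union> B)"
  unfolding approximable_set_def
proof (intro conjI allI impI)
  have AB: "A \<in> sets borel" "B \<in> sets borel" using A B by (auto simp: approximable_set_def)
  then show "A \<union> B \<in> sets borel" by auto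
  fix e :: real assume "0 < e"
  then have e: "0 < e / 2" by simp
  obtain \<phi> where \<phi>: "\<phi> \<in> test_functions S" "\<And>x. 0 \<le> \<phi> x \<and> \<phi> x \<le> 1" "(\<integral>x. \<bar>indicator A x - \<phi> x\<bar> \<partial>P) \<le> e / 2"
    using A e unfolding approximable_set_def by blast
  obtain \<psi> where \<psi>: "\<psi> \<in> test_functions S" "\<And>x. 0 \<le> \<psi> x \<and> \<psi> x \<le> 1" "(\<integral>x. \<bar>indicator B x - \<psi> x\<bar> \<partial>P) \<le> e / 2"
    using B e unfolding approximable_set_def by blast
  have max: "(\<lambda>x. max (\<phi> x) (\<psi> x)) \<in> test_functions S" by (intro test_functions_max \<phi> \<psi>)
  note int = indicator_error_integrable[OF AB(1) \<phi>(1)] indicator_error_integrable[OF AB(2) \<psi>(1)]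
  have "\<bar>indicator (A \<union> B) x - max (\<phi> x) (\<psi> x)\<bar> \<le> \<bar>indicator A x - \<phi> x\<bar> + \<bar>indicator B x - \<psi> x\<bar>" for x
    using \<phi>(2)[of x] \<psi>(2)[of x] by (auto simp: indicator_def max_def)
  then have "(\<integral>x. \<bar>indicator (A \<union> B) x - max (\<phi> x) (\<psi> x)\<bar> \<partial>P)
      \<le> (\<integral>x. \<bar>indicator A x - \<phi> x\<bar> + \<bar>indicator B x - \<psi> x\<bar> \<partial>P)"
    using AB by (intro integral_mono indicator_error_integrable max Bochner_Integration.integrable_add int) auto
  also have "\<dots> \<le> e" using \<phi>(3) \<psi>(3) int by simp
  finally show "\<exists>\<phi>\<in>test_functions S. (\<forall>x. 0 \<le> \<phi> x \<and> \<phi> x \<le> 1) \<and> (\<integral>x. \<bar>indicator (A \<union> B) x - \<phi> x\<bar> \<partial>P) \<le> e"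
    using max \<phi>(2) \<psi>(2) by (intro bexI[of _ "\<lambda>x. max (\<phi> x) (\<psi> x)"]) (auto simp: le_max_iff_disj)
qed

lemma approximable_set_UN:
  fixes A :: "nat \<Rightarrow> (real ^ 'n) set"
  assumes A: "\<And>i. approximable_set P S (A i)"
  shows "approximable_set P S (\<Union>i. A i)"
  unfolding approximable_set_def
proof (intro conjI allI impI)
  have Ai[measurable]: "A i \<in> sets borel" for i using A by (auto simp: approximable_set_def)
  then show U: "(\<Union>i. A i) \<in> sets borel" by auto
  define V where "V N = (\<Union>i<N. A i)" for N
  have V: "approximable_set P S (V N)" for N
    by (induction N) (auto simp: V_def lessThan_Suc approximable_set_empty intro!: approximable_set_Un A)
  have V_sets: "V N \<in> sets borel" for N using V by (auto simp: approximable_set_def)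
  fix e :: real assume e: "0 < e"
  have "(\<lambda>N. prob (V N)) \<longlonglongrightarrow> prob (\<Union>N. V N)"
    using V_sets by (intro finite_Lim_measure_incseq) (auto simp: sets_P V_def lessThan_Suc intro!: incseq_SucI)
  moreover have UV: "(\<Union>N. V N) = (\<Union>i. A i)" by (auto simp: V_def)
  ultimately have "\<forall>\<^sub>F N in sequentially. prob (\<Union>i. A i) - e / 2 < prob (V N)"
    using e by (intro order_tendstoD(1)) auto
  then obtain N where N: "prob (\<Union>i. A i) - e / 2 < prob (V N)"
    using eventually_happens by force
  obtain \<phi> where \<phi>: "\<phi> \<in> test_functions S" "\<And>x. 0 \<le> \<phi> x \<and> \<phi> x \<le> 1" "(\<integral>x. \<bar>indicator (V N) x - \<phi> x\<bar> \<partial>P) \<le> e / 2"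
    using V[of N] half_gt_zero[OF e] unfolding approximable_set_def by blast
  have sub: "V N \<subseteq> (\<Union>i. A i)" by (auto simp: V_def)
  note int = indicator_error_integrable[OF V_sets \<phi>(1), of N]
  have diff: "integrable P (indicat_real ((\<Union>i. A i) - V N))"
    using U V_sets by (intro integrable_real_indicator) (auto simp: sets_P less_top[symmetric])
  have "\<bar>indicator (\<Union>i. A i) x - \<phi> x\<bar> \<le> indicator ((\<Union>i. A i) - V N) x + \<bar>indicator (V N) x - \<phi> x\<bar>" for x
    using sub by (auto simp: indicator_def)
  then have "(\<integral>x. \<bar>indicator (\<Union>i. A i) x - \<phi> x\<bar> \<partial>P)
      \<le> (\<integral>x. indicator ((\<Union>i. A i) - V N) x + \<bar>indicator (V N) x - \<phi> x\<bar> \<partial>P)"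
    by (intro integral_mono indicator_error_integrable \<phi> U Bochner_Integration.integrable_add int diff)
  also have "\<dots> = prob ((\<Union>i. A i) - V N) + (\<integral>x. \<bar>indicator (V N) x - \<phi> x\<bar> \<partial>P)"
    using U V_sets by (subst Bochner_Integration.integral_add[OF diff int]) (auto simp: sets_P)
  also have "prob ((\<Union>i. A i) - V N) = prob (\<Union>i. A i) - prob (V N)"
    using U V_sets sub by (intro finite_measure_Diff) (auto simp: sets_P)
  finally have "(\<integral>x. \<bar>indicator (\<Union>i. A i) x - \<phi> x\<bar> \<partial>P) \<le> e" using N \<phi>(3) by linarith
  then show "\<exists>\<phi>\<in>test_functions S. (\<forall>x. 0 \<le> \<phi> x \<and> \<phi> x \<le> 1) \<and> (\<integral>x. \<bar>indicator (\<Union>i. A i) x - \<phi> x\<bar> \<partial>P) \<le> e"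
    using \<phi> by auto
qed

lemma approximable_set_halfspace:
  assumes s: "s \<in> S"
  shows "approximable_set P S {x. x $ s \<le> a}"
  unfolding approximable_set_def
proof (intro conjI allI impI)
  let ?A = "{x :: (real, 'n) vec. x $ s \<le> a}"
  show A[measurable]: "?A \<in> sets borel" by measurable
  define \<phi> where "\<phi> N x = max 0 (min 1 (1 - real N * (x $ s - a)))" for N and x :: "(real, 'n) vec"
  have \<phi>: "\<phi> N \<in> test_functions S" for N
  proof (rule test_functionsI[of _ 1 "real N"])
    fix x y :: "(real, 'n) vec"
    show "\<bar>\<phi> N x\<bar> \<le> 1" by (simp add: \<phi>_def)
    have "\<bar>\<phi> N x - \<phi> N y\<bar> \<le> \<bar>real N * (x $ s - a) - real N * (y $ s - a)\<bar>" by (auto simp: \<phi>_def)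
    also have "\<dots> = real N * \<bar>(x - y) $ s\<bar>" by (simp add: abs_mult flip: right_diff_distrib)
    also have "\<dots> \<le> real N * norm (x - y)" by (intro mult_left_mono component_le_norm_cart) auto
    finally show "\<bar>\<phi> N x - \<phi> N y\<bar> \<le> real N * norm (x - y)" .
  next
    fix x y :: "(real, 'n) vec" assume "\<And>s. s \<in> S \<Longrightarrow> x $ s = y $ s"
    then show "\<phi> N x = \<phi> N y" using s by (simp add: \<phi>_def)
  qed
  have lim: "(\<lambda>N. \<bar>indicator ?A x - \<phi> N x\<bar>) \<longlonglongrightarrow> 0" for x
  proof (rule tendsto_eventually)
    show "\<forall>\<^sub>F N in sequentially. \<bar>indicator ?A x - \<phi> N x\<bar> = 0"
    proof (cases "x $ s \<le> a")
      case True
      then have "real N * (x $ s - a) \<le> 0" for N by (simp add: mult_nonneg_nonpos)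
      then have "\<phi> N x = 1" for N unfolding \<phi>_def by (smt (verit))
      then show ?thesis using True by simp
    next
      case False
      have "\<forall>\<^sub>F N in sequentially. 1 / (x $ s - a) \<le> real N"
        using eventually_ge_at_top[of "nat \<lceil>1 / (x $ s - a)\<rceil>"] by eventually_elim linarith
      then show ?thesis
      proof eventually_elim
        case (elim N)
        then have "1 \<le> real N * (x $ s - a)" using False by (simp add: field_simps)
        then have "\<phi> N x = 0" unfolding \<phi>_def by simp
        then show ?case using False by simp
      qed
    qed
  qed
  have [measurable]: "?A \<in> sets P" "\<phi> N \<in> borel_measurable P" for N
    using A test_functions_measurable_P[OF \<phi>] by (auto simp: sets_P)
  have "(\<lambda>N. \<integral>x. \<bar>indicator ?A x - \<phi> N x\<bar> \<partial>P) \<longlonglongrightarrow> (\<integral>x. 0 \<partial>P)"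
  proof (rule integral_dominated_convergence[where w = "\<lambda>_. 1"])
    show "AE x in P. norm \<bar>indicator ?A x - \<phi> N x\<bar> \<le> 1" for N
      by (intro AE_I2) (auto simp: \<phi>_def indicator_def)
  qed (use lim in auto)
  moreover fix e :: real assume "0 < e"
  ultimately have "\<forall>\<^sub>F N in sequentially. (\<integral>x. \<bar>indicator ?A x - \<phi> N x\<bar> \<partial>P) < e"
    by (auto dest!: order_tendstoD(2))
  then obtain N where "(\<integral>x. \<bar>indicator ?A x - \<phi> N x\<bar> \<partial>P) < e" using eventually_happens by force
  then show "\<exists>\<phi>\<in>test_functions S. (\<forall>x. 0 \<le> \<phi> x \<and> \<phi> x \<le> 1) \<and> (\<integral>x. \<bar>indicator ?A x - \<phi> x\<bar> \<partial>P) \<le> e"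
    using \<phi>[of N] by (intro bexI[of _ "\<phi> N"]) (auto simp: \<phi>_def)
qed

lemma approximable_set_process_algebra:
  assumes A: "A \<in> sets (process_algebra (\<lambda>x. x) S)"
  shows "approximable_set P S A"
proof -
  have base: "approximable_set P S ((\<lambda>x. x $ s) -` B)" if s: "s \<in> S" and B: "B \<in> sets borel" for s B
  proof -
    have "B \<in> sigma_sets UNIV (range (\<lambda>a::real. {..a}))"
      using B by (subst (asm) borel_eq_atMost) (simp add: sets_measure_of)
    then show ?thesis
    proof induction
      case (Basic B)
      then show ?case using approximable_set_halfspace[OF s] by (auto simp: vimage_def)
    next
      case Empty
      then show ?case using approximable_set_empty by simp
    next
      case (Compl B)
      then show ?case using approximable_set_Compl by (simp add: vimage_Diff)
    next
      case (Union B)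
      then show ?case using approximable_set_UN[of "\<lambda>i. (\<lambda>x. x $ s) -` B i"] by (simp add: vimage_UN)
    qed
  qed
  have "A \<in> sigma_sets UNIV {(\<lambda>x. x $ s) -` B | s B. s \<in> S \<and> B \<in> sets borel}"
    using A by (simp add: sets_process_algebra)
  then show ?thesis
  proof induction
    case (Basic A)
    then show ?case using base by auto
  qed (auto intro: approximable_set_empty approximable_set_Compl approximable_set_UN)
qed

end

text \<open>Membership of \<open>u\<close> in the \<open>L\<^sup>p(P)\<close> closure of the test functions of the coordinates in \<open>S\<close>. For
  \<open>u \<notin> L\<^sup>p(P)\<close> the integral may be the default value \<open>0\<close>, so the notion is used for \<open>u \<in> L\<^sup>p(P)\<close> only.\<close>

definition Lp_approximable :: "(real ^ 'n::finite) measure \<Rightarrow> real \<Rightarrow> 'n set \<Rightarrow> (real ^ 'n \<Rightarrow> real) \<Rightarrow> bool" where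
  "Lp_approximable P p S u \<longleftrightarrow> (\<forall>e>0. \<exists>\<phi>\<in>test_functions S. (\<integral>x. \<bar>u x - \<phi> x\<bar> powr p \<partial>P) \<le> e)"

lemma integral_add_powr_le:
  fixes u v :: "'a \<Rightarrow> real"
  assumes [measurable]: "u \<in> borel_measurable M" "v \<in> borel_measurable M"
    and u: "integrable M (\<lambda>x. \<bar>u x\<bar> powr p)" and v: "integrable M (\<lambda>x. \<bar>v x\<bar> powr p)" and p: "0 < p"
  shows "integrable M (\<lambda>x. \<bar>u x + v x\<bar> powr p)"
    and "(\<integral>x. \<bar>u x + v x\<bar> powr p \<partial>M) \<le> 2 powr p * ((\<integral>x. \<bar>u x\<bar> powr p \<partial>M) + (\<integral>x. \<bar>v x\<bar> powr p \<partial>M))"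
proof -
  have le: "\<bar>u x + v x\<bar> powr p \<le> 2 powr p * (\<bar>u x\<bar> powr p + \<bar>v x\<bar> powr p)" for x
    using p by (intro order_trans[OF powr_mono2 add_powr_le]) auto
  have int: "integrable M (\<lambda>x. 2 powr p * (\<bar>u x\<bar> powr p + \<bar>v x\<bar> powr p))" using u v by auto
  show *: "integrable M (\<lambda>x. \<bar>u x + v x\<bar> powr p)"
    by (rule Bochner_Integration.integrable_bound[OF int]) (use le in \<open>auto intro: order_trans[OF _ abs_ge_self]\<close>)
  have "(\<integral>x. \<bar>u x + v x\<bar> powr p \<partial>M) \<le> (\<integral>x. 2 powr p * (\<bar>u x\<bar> powr p + \<bar>v x\<bar> powr p) \<partial>M)"
    by (intro integral_mono * int le)
  then show "(\<integral>x. \<bar>u x + v x\<bar> powr p \<partial>M) \<le> 2 powr p * ((\<integral>x. \<bar>u x\<bar> powr p \<partial>M) + (\<integral>x. \<bar>v x\<bar> powr p \<partial>M))"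
    using u v by simp
qed

context
  fixes P :: "(real ^ 'n::finite) measure" and S :: "'n set" and p :: real
  assumes P: "prob_space P" and sets_P: "sets P = sets borel" and p: "1 \<le> p"
begin

interpretation prob_space P by (rule P)

lemma test_functions_powr_integrable:
  assumes "\<phi> \<in> test_functions S"
  shows "integrable P (\<lambda>x. \<bar>\<phi> x\<bar> powr p)"
proof -
  obtain B where B: "\<And>x. \<bar>\<phi> x\<bar> \<le> B" using test_functions_bounded[OF assms] by blast
  have [measurable]: "\<phi> \<in> borel_measurable P"
    using test_functions_measurable_P[OF P sets_P assms] .
  have "\<bar>\<phi> x\<bar> powr p \<le> B powr p" for x using B[of x] p by (intro powr_mono2) auto
  then show ?thesis by (intro integrable_const_bound[where B = "B powr p"]) auto
qed

lemma test_functions_error_integrable: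
  assumes "\<phi> \<in> test_functions S" and "u \<in> borel_measurable P" "integrable P (\<lambda>x. \<bar>u x\<bar> powr p)"
  shows "integrable P (\<lambda>x. \<bar>u x - \<phi> x\<bar> powr p)"
proof -
  have [measurable]: "\<phi> \<in> borel_measurable P"
    using test_functions_measurable_P[OF P sets_P assms(1)] .
  show ?thesis
    using integral_add_powr_le(1)[of u P "\<lambda>x. - \<phi> x" p] assms test_functions_powr_integrable[OF assms(1)] p
    by simp
qed

lemma Lp_approximable_add:
  assumes uv[measurable]: "u \<in> borel_measurable P" "v \<in> borel_measurable P"
    and int: "integrable P (\<lambda>x. \<bar>u x\<bar> powr p)" "integrable P (\<lambda>x. \<bar>v x\<bar> powr p)"
    and u: "Lp_approximable P p S u" and v: "Lp_approximable P p S v"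
  shows "Lp_approximable P p S (\<lambda>x. u x + v x)"
  unfolding Lp_approximable_def
proof (intro allI impI)
  fix e :: real assume "0 < e"
  then have e: "0 < e / (2 * 2 powr p)" by simp
  obtain \<phi> where \<phi>: "\<phi> \<in> test_functions S" "(\<integral>x. \<bar>u x - \<phi> x\<bar> powr p \<partial>P) \<le> e / (2 * 2 powr p)"
    using u e unfolding Lp_approximable_def by blast
  obtain \<psi> where \<psi>: "\<psi> \<in> test_functions S" "(\<integral>x. \<bar>v x - \<psi> x\<bar> powr p \<partial>P) \<le> e / (2 * 2 powr p)"
    using v e unfolding Lp_approximable_def by blast
  have [measurable]: "\<phi> \<in> borel_measurable P" "\<psi> \<in> borel_measurable P"
    using test_functions_measurable_P[OF P sets_P] \<phi> \<psi> by auto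
  have "(\<integral>x. \<bar>(u x - \<phi> x) + (v x - \<psi> x)\<bar> powr p \<partial>P)
      \<le> 2 powr p * ((\<integral>x. \<bar>u x - \<phi> x\<bar> powr p \<partial>P) + (\<integral>x. \<bar>v x - \<psi> x\<bar> powr p \<partial>P))"
    using p by (intro integral_add_powr_le test_functions_error_integrable \<phi> \<psi> uv int) auto
  also have "\<dots> \<le> 2 powr p * (e / (2 * 2 powr p) + e / (2 * 2 powr p))"
    using \<phi> \<psi> by (intro mult_left_mono add_mono) auto
  also have "\<dots> = e" by simp
  finally have "(\<integral>x. \<bar>u x + v x - (\<phi> x + \<psi> x)\<bar> powr p \<partial>P) \<le> e" by (simp add: algebra_simps)
  then show "\<exists>\<phi>\<in>test_functions S. (\<integral>x. \<bar>u x + v x - \<phi> x\<bar> powr p \<partial>P) \<le> e"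
    using test_functions_add[OF \<phi>(1) \<psi>(1)] by (intro bexI[of _ "\<lambda>x. \<phi> x + \<psi> x"])
qed

lemma Lp_approximable_cmult:
  assumes u: "Lp_approximable P p S u"
  shows "Lp_approximable P p S (\<lambda>x. c * u x)"
  unfolding Lp_approximable_def
proof (intro allI impI)
  fix e :: real assume "0 < e"
  then have e: "0 < e / (1 + \<bar>c\<bar> powr p)" by (simp add: add_pos_nonneg)
  obtain \<phi> where \<phi>: "\<phi> \<in> test_functions S" "(\<integral>x. \<bar>u x - \<phi> x\<bar> powr p \<partial>P) \<le> e / (1 + \<bar>c\<bar> powr p)"
    using u e unfolding Lp_approximable_def by blast
  have "\<bar>c * u x - c * \<phi> x\<bar> powr p = \<bar>c\<bar> powr p * \<bar>u x - \<phi> x\<bar> powr p" for x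
    by (simp add: abs_mult powr_mult flip: right_diff_distrib)
  then have "(\<integral>x. \<bar>c * u x - c * \<phi> x\<bar> powr p \<partial>P) = \<bar>c\<bar> powr p * (\<integral>x. \<bar>u x - \<phi> x\<bar> powr p \<partial>P)"
    by simp
  also have "\<dots> \<le> (1 + \<bar>c\<bar> powr p) * (e / (1 + \<bar>c\<bar> powr p))" using \<phi> by (intro mult_mono) auto
  also have "\<dots> = e" using powr_ge_zero[of "\<bar>c\<bar>" p] by (simp add: add_nonneg_eq_0_iff)
  finally show "\<exists>\<phi>\<in>test_functions S. (\<integral>x. \<bar>c * u x - \<phi> x\<bar> powr p \<partial>P) \<le> e"
    using test_functions_cmult[OF \<phi>(1), of c] by (intro bexI[of _ "\<lambda>x. c * \<phi> x"])
qed

lemma Lp_approximable_limit: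
  assumes [measurable]: "u \<in> borel_measurable P" and U_meas[measurable]: "\<And>i. U i \<in> borel_measurable P"
    and int: "integrable P (\<lambda>x. \<bar>u x\<bar> powr p)"
    and U: "\<And>i. Lp_approximable P p S (U i)" and le: "\<And>i x. 0 \<le> U i x \<and> U i x \<le> u x"
    and lim: "\<And>x. (\<lambda>i. U i x) \<longlonglongrightarrow> u x"
  shows "Lp_approximable P p S u"
  unfolding Lp_approximable_def
proof (intro allI impI)
  fix e :: real assume "0 < e"
  then have e: "0 < e / (2 * 2 powr p)" by simp
  have le1: "\<bar>u x - U i x\<bar> powr p \<le> \<bar>u x\<bar> powr p" and le2: "\<bar>U i x\<bar> powr p \<le> \<bar>u x\<bar> powr p" for i x
    using le[of i x] p by (auto intro!: powr_mono2)
  have "(\<lambda>i. \<bar>u x - U i x\<bar> powr p) \<longlonglongrightarrow> 0" for x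
  proof -
    have "(\<lambda>i. \<bar>u x - U i x\<bar>) \<longlonglongrightarrow> 0"
      using tendsto_diff[OF tendsto_const[of "u x"] lim[of x]] by (intro tendsto_rabs_zero) simp
    then show ?thesis using p by (intro tendsto_zero_powrI[where b = p]) auto
  qed
  then have "(\<lambda>i. \<integral>x. \<bar>u x - U i x\<bar> powr p \<partial>P) \<longlonglongrightarrow> (\<integral>x. 0 \<partial>P)"
    using le1 by (intro integral_dominated_convergence[OF _ _ int]) auto
  then have "\<forall>\<^sub>F i in sequentially. (\<integral>x. \<bar>u x - U i x\<bar> powr p \<partial>P) < e / (2 * 2 powr p)"
    using e by (auto dest!: order_tendstoD(2))
  then obtain i where i: "(\<integral>x. \<bar>u x - U i x\<bar> powr p \<partial>P) < e / (2 * 2 powr p)"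
    using eventually_happens by force
  obtain \<phi> where \<phi>: "\<phi> \<in> test_functions S" "(\<integral>x. \<bar>U i x - \<phi> x\<bar> powr p \<partial>P) \<le> e / (2 * 2 powr p)"
    using U[of i] e unfolding Lp_approximable_def by blast
  have [measurable]: "\<phi> \<in> borel_measurable P"
    using test_functions_measurable_P[OF P sets_P \<phi>(1)] .
  have "integrable P (\<lambda>x. \<bar>U i x\<bar> powr p)"
    by (rule Bochner_Integration.integrable_bound[OF int]) (use le2 in auto)
  then have int_\<phi>: "integrable P (\<lambda>x. \<bar>U i x - \<phi> x\<bar> powr p)"
    by (rule test_functions_error_integrable[OF \<phi>(1) U_meas])
  have "integrable P (\<lambda>x. \<bar>u x - U i x\<bar> powr p)"
    by (rule Bochner_Integration.integrable_bound[OF int]) (use le1 in auto)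
  then have "(\<integral>x. \<bar>(u x - U i x) + (U i x - \<phi> x)\<bar> powr p \<partial>P)
      \<le> 2 powr p * ((\<integral>x. \<bar>u x - U i x\<bar> powr p \<partial>P) + (\<integral>x. \<bar>U i x - \<phi> x\<bar> powr p \<partial>P))"
    using p int_\<phi> by (intro integral_add_powr_le) auto
  also have "\<dots> \<le> 2 powr p * (e / (2 * 2 powr p) + e / (2 * 2 powr p))"
    using \<phi> i by (intro mult_left_mono add_mono) auto
  also have "\<dots> = e" by simp
  finally show "\<exists>\<phi>\<in>test_functions S. (\<integral>x. \<bar>u x - \<phi> x\<bar> powr p \<partial>P) \<le> e"
    using \<phi>(1) by (intro bexI[of _ \<phi>]) simp_all
qed

lemma Lp_approximable_indicator:
  assumes A: "A \<in> sets (process_algebra (\<lambda>x. x) S)"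
  shows "Lp_approximable P p S (indicator A)"
  unfolding Lp_approximable_def
proof (intro allI impI)
  fix e :: real assume "0 < e"
  then obtain \<phi> where \<phi>: "\<phi> \<in> test_functions S" "\<And>x. 0 \<le> \<phi> x \<and> \<phi> x \<le> 1"
      "(\<integral>x. \<bar>indicator A x - \<phi> x\<bar> \<partial>P) \<le> e" and A': "A \<in> sets borel"
    using approximable_set_process_algebra[OF P sets_P A] unfolding approximable_set_def by blast
  have le: "\<bar>indicator A x - \<phi> x\<bar> powr p \<le> \<bar>indicator A x - \<phi> x\<bar>" for x
    using powr_mono'[OF p, of "\<bar>indicator A x - \<phi> x\<bar>"] \<phi>(2)[of x] by (auto simp: indicator_def)
  have [measurable]: "A \<in> sets P" "\<phi> \<in> borel_measurable P"
    using A' test_functions_measurable_P[OF P sets_P \<phi>(1)] by (simp_all add: sets_P)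
  have int: "integrable P (\<lambda>x. \<bar>indicator A x - \<phi> x\<bar>)"
    by (rule indicator_error_integrable[OF P sets_P A' \<phi>(1)])
  have "integrable P (\<lambda>x. \<bar>indicator A x - \<phi> x\<bar> powr p)"
    by (rule Bochner_Integration.integrable_bound[OF int]) (use le in auto)
  then have "(\<integral>x. \<bar>indicator A x - \<phi> x\<bar> powr p \<partial>P) \<le> (\<integral>x. \<bar>indicator A x - \<phi> x\<bar> \<partial>P)"
    by (intro integral_mono int le)
  then show "\<exists>\<phi>\<in>test_functions S. (\<integral>x. \<bar>indicator A x - \<phi> x\<bar> powr p \<partial>P) \<le> e"
    using \<phi> by force
qed

lemma Lp_approximable_nonneg:
  assumes u: "u \<in> borel_measurable (process_algebra (\<lambda>x. x) S)" "\<And>x. 0 \<le> u x"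
    and int: "integrable P (\<lambda>x. \<bar>u x\<bar> powr p)"
  shows "Lp_approximable P p S u"
  using u int
proof (induction rule: borel_measurable_induct_real)
  have sub: "subalgebra P (process_algebra (\<lambda>x. x) S)"
    using sets_eq_imp_space_eq[OF sets_P] by (intro subalgebra_process_algebra) (auto simp: sets_P cong: measurable_cong_sets)
  have meas: "w \<in> borel_measurable P" if "w \<in> borel_measurable (process_algebra (\<lambda>x. x) S)" for w :: "_ \<Rightarrow> real"
    using sub that by (rule measurable_from_subalg)
  {
    case (set A)
    then show ?case by (intro Lp_approximable_indicator)
  next
    case (mult u c)
    show ?case
    proof (cases "c = 0")
      case True
      then show ?thesis
        by (auto simp: Lp_approximable_def intro!: bexI[of _ "\<lambda>x. 0"] test_functions_const)
    next
      case False
      have "integrable P (\<lambda>x. \<bar>c\<bar> powr p * \<bar>u x\<bar> powr p)" using mult.prems by (simp add: abs_mult powr_mult)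
      then show ?thesis using False by (intro Lp_approximable_cmult mult.IH) simp
    qed
  next
    case (add u v)
    note [measurable] = meas[OF add.hyps(1)] meas[OF add.hyps(3)]
    have "integrable P (\<lambda>x. \<bar>u x\<bar> powr p)" "integrable P (\<lambda>x. \<bar>v x\<bar> powr p)"
      using add.hyps(2,4) p
      by (auto intro!: Bochner_Integration.integrable_bound[OF add.prems] powr_mono2 AE_I2)
    then show ?case using add.IH by (intro Lp_approximable_add) auto
  next
    case (seq U)
    have Uu: "0 \<le> U i x \<and> U i x \<le> u x" for i x
      using incseq_le[of "\<lambda>i. U i x" "u x"] seq.hyps by (auto simp: incseq_def le_fun_def)
    then have "\<bar>U i x\<bar> powr p \<le> \<bar>u x\<bar> powr p" for i x
      using p by (intro powr_mono2) (auto intro: order_trans[OF _ abs_ge_self])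
    then have "integrable P (\<lambda>x. \<bar>U i x\<bar> powr p)" for i
      using meas[OF seq.hyps(1)]
      by (intro Bochner_Integration.integrable_bound[OF seq.prems]) auto
    then have "Lp_approximable P p S (U i)" for i by (rule seq.IH)
    then show ?case
      by (rule Lp_approximable_limit[OF meas[OF u(1)] meas[OF seq.hyps(1)] seq.prems _ Uu])
         (rule seq.hyps, simp)
  }
qed

text \<open>Test functions are dense in \<open>L\<^sup>p(\<sigma>(X\<^sub>s : s \<in> S))\<close>.\<close>

proposition test_functions_dense:
  assumes u: "u \<in> borel_measurable (process_algebra (\<lambda>x. x) S)"
    and int: "integrable P (\<lambda>x. \<bar>u x\<bar> powr p)"
  shows "Lp_approximable P p S u"
proof -
  have "subalgebra P (process_algebra (\<lambda>x. x) S)"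
    using sets_eq_imp_space_eq[OF sets_P] by (intro subalgebra_process_algebra) (auto simp: sets_P cong: measurable_cong_sets)
  from measurable_from_subalg[OF this u] have [measurable]: "u \<in> borel_measurable P" .
  have int': "integrable P (\<lambda>x. \<bar>max 0 (u x)\<bar> powr p)" "integrable P (\<lambda>x. \<bar>max 0 (- u x)\<bar> powr p)"
    using p by (auto intro!: Bochner_Integration.integrable_bound[OF int] powr_mono2 AE_I2)
  have "Lp_approximable P p S (\<lambda>x. max 0 (u x))" "Lp_approximable P p S (\<lambda>x. max 0 (- u x))"
    using u int' by (auto intro!: Lp_approximable_nonneg)
  then have "Lp_approximable P p S (\<lambda>x. max 0 (u x) + (-1) * max 0 (- u x))"
    using int' by (intro Lp_approximable_add Lp_approximable_cmult) auto
  moreover have "max 0 (u x) + (-1) * max 0 (- u x) = u x" for x by auto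
  ultimately show ?thesis by simp
qed

end

section \<open>Adapted perturbations of the identity\<close>

lemma test_functions_perturbation_adapted:
  fixes \<phi> :: "'n::{finite,linorder} \<Rightarrow> (real ^ 'n::{finite,linorder}) \<Rightarrow> real"
  assumes \<phi>: "\<And>t. \<phi> t \<in> test_functions {..t}"
  shows "adapted_map (\<lambda>x. x + r *\<^sub>R (\<chi> t. \<phi> t x))"
  unfolding adapted_map_def
proof (intro conjI allI impI)
  show "continuous_on UNIV (\<lambda>x. x + r *\<^sub>R (\<chi> t. \<phi> t x))"
    by (intro continuous_intros continuous_on_vec_lambda test_functions_continuous[OF \<phi>])
  fix t s :: 'n and x y :: "(real, 'n) vec"
  assume xy: "\<forall>s\<le>t. x $ s = y $ s" and s: "s \<le> t"
  have "\<phi> s x = \<phi> s y" using xy s by (intro test_functions_cong[OF \<phi>]) auto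
  then show "(x + r *\<^sub>R (\<chi> t. \<phi> t x)) $ s = (y + r *\<^sub>R (\<chi> t. \<phi> t y)) $ s" using xy s by simp
qed

text \<open>A small adapted Lipschitz perturbation of the identity has an adapted inverse. The inverse
  exists by Banach's fixed point theorem. It is adapted since, for two paths \<open>y\<close> and \<open>y'\<close> that agree
  up to time \<open>t\<close>, the preimages stopped at \<open>t\<close> differ by at most half of their own distance.\<close>

proposition test_functions_perturbation_invertible:
  fixes \<phi> :: "'n::{finite,linorder} \<Rightarrow> (real ^ 'n::{finite,linorder}) \<Rightarrow> real"
  assumes \<phi>: "\<And>t. \<phi> t \<in> test_functions {..t}"
  shows "\<exists>r0>0. \<forall>r. 0 < r \<longrightarrow> r < r0 \<longrightarrow>
    (\<exists>\<Theta>. adapted_map \<Theta> \<and> (\<forall>x. \<Theta> (x + r *\<^sub>R (\<chi> t. \<phi> t x)) = x))"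
proof -
  obtain L where L: "\<And>t. 0 \<le> L t" "\<And>t x y. \<bar>\<phi> t x - \<phi> t y\<bar> \<le> L t * norm (x - y)"
    using test_functions_lipschitz[OF \<phi>] by metis
  define \<Lambda> where "\<Lambda> = 1 + (\<Sum>t\<in>UNIV. L t)"
  have \<Lambda>: "0 < \<Lambda>" using L by (auto simp: \<Lambda>_def intro!: add_pos_nonneg sum_nonneg)
  have "\<exists>\<Theta>. adapted_map \<Theta> \<and> (\<forall>x. \<Theta> (x + r *\<^sub>R (\<chi> t. \<phi> t x)) = x)" if r: "0 < r" "r < 1 / (2 * \<Lambda>)" for r
  proof -
    have r\<Lambda>: "r * (\<Sum>t\<in>UNIV. L t) \<le> 1 / 2"
    proof -
      have "r * (\<Sum>t\<in>UNIV. L t) \<le> r * \<Lambda>" using r by (intro mult_left_mono) (auto simp: \<Lambda>_def)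
      also have "\<dots> \<le> 1 / 2" using r \<Lambda> by (simp add: field_simps)
      finally show ?thesis .
    qed
    define \<Phi> where "\<Phi> x = (\<chi> t. \<phi> t x)" for x
    have \<Phi>: "norm (r *\<^sub>R \<Phi> x - r *\<^sub>R \<Phi> y) \<le> 1 / 2 * norm (x - y)" for x y
    proof -
      have "norm (\<Phi> x - \<Phi> y) \<le> (\<Sum>t\<in>UNIV. \<bar>(\<Phi> x - \<Phi> y) $ t\<bar>)" by (rule norm_le_l1_cart)
      also have "\<dots> \<le> (\<Sum>t\<in>UNIV. L t * norm (x - y))" by (intro sum_mono) (simp add: \<Phi>_def L)
      also have "\<dots> = (\<Sum>t\<in>UNIV. L t) * norm (x - y)" by (simp add: sum_distrib_right)
      finally have "r * norm (\<Phi> x - \<Phi> y) \<le> r * (\<Sum>t\<in>UNIV. L t) * norm (x - y)"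
        using r by (simp add: mult.assoc)
      also have "\<dots> \<le> 1 / 2 * norm (x - y)" using r\<Lambda> by (intro mult_right_mono) auto
      finally show ?thesis using r by (simp flip: scaleR_diff_right)
    qed
    have "\<exists>x. x + r *\<^sub>R \<Phi> x = y" for y
    proof -
      have "\<exists>!x. y - r *\<^sub>R \<Phi> x = x"
      proof (rule banach_fix_type[of "1 / 2"])
        show "\<forall>x x'. dist (y - r *\<^sub>R \<Phi> x) (y - r *\<^sub>R \<Phi> x') \<le> 1 / 2 * dist x x'"
          using \<Phi> by (simp add: dist_norm norm_minus_commute)
      qed auto
      then obtain x where "y - r *\<^sub>R \<Phi> x = x" by blast
      then have "x + r *\<^sub>R \<Phi> x = y" by (metis diff_add_cancel)
      then show ?thesis ..
    qed
    then obtain \<Theta> where \<Theta>: "\<And>y. \<Theta> y + r *\<^sub>R \<Phi> (\<Theta> y) = y" by metis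
    have lip: "norm (\<Theta> y - \<Theta> y') \<le> 2 * norm (y - y')" for y y'
    proof -
      have "\<Theta> y - \<Theta> y' = (y - y') - (r *\<^sub>R \<Phi> (\<Theta> y) - r *\<^sub>R \<Phi> (\<Theta> y'))"
        using \<Theta>[of y] \<Theta>[of y'] by (simp add: algebra_simps)
      then have "norm (\<Theta> y - \<Theta> y') \<le> norm (y - y') + norm (r *\<^sub>R \<Phi> (\<Theta> y) - r *\<^sub>R \<Phi> (\<Theta> y'))"
        by (metis norm_triangle_ineq4)
      then show ?thesis using \<Phi>[of "\<Theta> y" "\<Theta> y'"] by simp
    qed
    have "adapted_map \<Theta>" unfolding adapted_map_def
    proof (intro conjI allI impI)
      have "2-lipschitz_on UNIV \<Theta>" using lip by (intro lipschitz_onI) (auto simp: dist_norm)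
      then show "continuous_on UNIV \<Theta>" by (rule lipschitz_on_continuous_on)
      fix t s :: 'n and y y' :: "(real, 'n) vec"
      assume yy': "\<forall>s\<le>t. y $ s = y' $ s" and s: "s \<le> t"
      \<comment> \<open>The part of a path up to time \<open>t\<close>.\<close>
      define pr where "pr v = (\<chi> s. if s \<le> t then v $ s else 0)" for v :: "(real, 'n) vec"
      let ?N = "norm (pr (\<Theta> y) - pr (\<Theta> y'))"
      have comp: "\<bar>\<Theta> y $ s - \<Theta> y' $ s\<bar> \<le> r * L s * ?N" if s: "s \<le> t" for s
      proof -
        have pr_eq: "\<phi> s v = \<phi> s (pr v)" for v
          using s by (intro test_functions_cong[OF \<phi>]) (auto simp: pr_def)
        have "\<Theta> y $ s + r * \<phi> s (\<Theta> y) = y $ s" "\<Theta> y' $ s + r * \<phi> s (\<Theta> y') = y' $ s"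
          using \<Theta>[of y] \<Theta>[of y'] by (auto simp: vec_eq_iff \<Phi>_def)
        then have "\<Theta> y $ s - \<Theta> y' $ s = r * (\<phi> s (\<Theta> y') - \<phi> s (\<Theta> y))"
          using yy' s by (simp add: algebra_simps)
        then have "\<bar>\<Theta> y $ s - \<Theta> y' $ s\<bar> = r * \<bar>\<phi> s (pr (\<Theta> y)) - \<phi> s (pr (\<Theta> y'))\<bar>"
          using r pr_eq by (simp add: abs_mult abs_minus_commute)
        also have "\<dots> \<le> r * (L s * ?N)" using r L by (intro mult_left_mono) auto
        finally show ?thesis by simp
      qed
      have "?N \<le> (\<Sum>s\<in>UNIV. \<bar>(pr (\<Theta> y) - pr (\<Theta> y')) $ s\<bar>)" by (rule norm_le_l1_cart)
      also have "\<dots> \<le> (\<Sum>s\<in>UNIV. r * L s * ?N)"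
        using comp r L by (intro sum_mono) (auto simp: pr_def)
      also have "\<dots> = r * (\<Sum>s\<in>UNIV. L s) * ?N" by (simp add: sum_distrib_left sum_distrib_right)
      also have "\<dots> \<le> 1 / 2 * ?N" using r\<Lambda> by (intro mult_right_mono) auto
      finally have "?N = 0" by simp
      then show "\<Theta> y $ s = \<Theta> y' $ s" using comp[OF s] by simp
    qed
    moreover have "\<Theta> (x + r *\<^sub>R \<Phi> x) = x" for x
    proof -
      let ?x = "\<Theta> (x + r *\<^sub>R \<Phi> x)"
      have "?x + r *\<^sub>R \<Phi> ?x = x + r *\<^sub>R \<Phi> x" by (rule \<Theta>)
      then have "?x - x = r *\<^sub>R \<Phi> x - r *\<^sub>R \<Phi> ?x" by (simp add: algebra_simps)
      then have "norm (?x - x) \<le> 1 / 2 * norm (x - ?x)" using \<Phi>[of x ?x] by (simp only:)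
      then have "norm (?x - x) = 0" by (simp add: norm_minus_commute)
      then show ?thesis by simp
    qed
    ultimately show ?thesis unfolding \<Phi>_def by blast
  qed
  then show ?thesis using \<Lambda> by (intro exI[of _ "1 / (2 * \<Lambda>)"]) auto
qed

text \<open>Transport along an adapted map with adapted inverse is bicausal: each of the two processes is
  an adapted function of the other.\<close>

lemma bicausal_coupling_adapted_map:
  fixes P :: "(real ^ 'n::{finite,linorder}) measure"
  assumes P: "prob_space P" "sets P = sets borel"
    and \<Psi>: "adapted_map \<Psi>" and \<Theta>: "adapted_map \<Theta>" "\<And>x. \<Theta> (\<Psi> x) = x"
  shows "distr P borel (\<lambda>x. (x, \<Psi> x)) \<in> bicausal_couplings P (distr P borel \<Psi>)"
proof -
  let ?\<pi> = "distr P borel (\<lambda>x. (x, \<Psi> x))"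
  note [measurable_cong] = P(2) and [measurable] = adapted_map_measurable[OF \<Psi>] adapted_map_measurable[OF \<Theta>(1)]
  have m[measurable]: "(\<lambda>x. (x, \<Psi> x)) \<in> measurable P borel"
    unfolding borel_prod[symmetric] by measurable
  have fs[measurable]: "fst \<in> borel_measurable (borel :: ((real, 'n) vec \<times> (real, 'n) vec) measure)"
    "snd \<in> borel_measurable (borel :: ((real, 'n) vec \<times> (real, 'n) vec) measure)"
    unfolding borel_prod[symmetric] by simp_all
  have prob: "prob_space ?\<pi>" using P(1) m by (rule prob_space.prob_space_distr)
  have sp: "space ?\<pi> = UNIV" by simp
  have "distr ?\<pi> borel fst = P" "distr ?\<pi> borel snd = distr P borel \<Psi>"
    using P(2) by (simp_all add: distr_distr comp_def distr_id2)
  moreover have "causal ?\<pi> fst snd"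
    by (rule causal_adapted_map[OF prob sp _ _ \<Psi>]) (auto simp: AE_distr_iff)
  moreover have "causal ?\<pi> snd fst"
    by (rule causal_adapted_map[OF prob sp _ _ \<Theta>(1)]) (auto simp: AE_distr_iff \<Theta>(2))
  ultimately show ?thesis using prob by (simp add: bicausal_couplings_def couplings_def)
qed

section \<open>Sensitivity of the worst case expectation\<close>

text \<open>A function \<open>f\<close> with continuous gradient \<open>G\<close> of growth \<open>p - 1\<close>, and a law \<open>P\<close> with finite
  \<open>p\<close>-th moment.\<close>

locale differentiable_growth =
  fixes p q C :: real and f :: "real ^ 'n::{finite,linorder} \<Rightarrow> real"
    and G :: "real ^ 'n::{finite,linorder} \<Rightarrow> real ^ 'n::{finite,linorder}"
    and P :: "(real ^ 'n::{finite,linorder}) measure"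
  assumes pq: "conjugate_exponents p q"
    and der: "\<And>x. (f has_derivative (\<lambda>h. G x \<bullet> h)) (at x)" and cont: "continuous_on UNIV G"
    and C: "0 < C" and growth: "\<And>x. norm (G x) \<le> C * (1 + norm x powr (p - 1))"
    and P: "P \<in> finite_moment_measures p"
begin

lemmas PD = finite_moment_measuresD[OF P]
lemmas pqD = conjugate_exponentsD[OF pq]

sublocale prob_space P by (rule PD)

text \<open>The conditional expectation of the \<open>t\<close>-th partial derivative given the path up to time \<open>t\<close>.\<close>

definition proj_grad :: "'n \<Rightarrow> real ^ 'n::{finite,linorder} \<Rightarrow> real" where
  "proj_grad t = real_cond_exp P (process_algebra (\<lambda>x. x) {..t}) (\<lambda>x. G x $ t)"

text \<open>The coefficient of \<open>r\<close> in the expansion: the norm of the family \<^term>\<open>proj_grad\<close> in \<open>L\<^sup>q\<close> of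
  the product of the time points and path space.\<close>

definition sens :: real where
  "sens = (\<Sum>t\<in>UNIV. \<integral>x. \<bar>proj_grad t x\<bar> powr q \<partial>P) powr (1 / q)"

lemma G_measurable [measurable]: "G \<in> borel_measurable borel"
  using cont by (rule borel_measurable_continuous_onI)

lemma measurable_P_iff: "g \<in> borel_measurable P \<longleftrightarrow> g \<in> borel_measurable borel"
  using PD(2) by (simp cong: measurable_cong_sets)

lemma subalgebra_past: "subalgebra P (process_algebra (\<lambda>x. x) S)"
  using PD by (intro subalgebra_process_algebra) (auto simp: measurable_P_iff)

lemma G_powr_integrable: "integrable P (\<lambda>x. \<bar>G x $ t\<bar> powr q)"
proof (rule Bochner_Integration.integrable_bound)
  show "integrable P (\<lambda>x. C powr q * 2 powr q * (1 + norm x powr p))" using PD(4) by auto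
  have "\<bar>G x $ t\<bar> powr q \<le> C powr q * 2 powr q * (1 + norm x powr p)" for x
    using C by (intro growth_powr_conjugate[OF pq]) (auto intro: order_trans[OF component_le_norm_cart growth])
  then show "AE x in P. norm (\<bar>G x $ t\<bar> powr q) \<le> norm (C powr q * 2 powr q * (1 + norm x powr p))"
    by (intro AE_I2) (auto intro: order_trans[OF _ abs_ge_self])
qed (simp add: measurable_P_iff)

lemma proj_grad_measurable_past: "proj_grad t \<in> borel_measurable (process_algebra (\<lambda>x. x) {..t})"
  unfolding proj_grad_def by (rule borel_measurable_cond_exp)

lemma proj_grad_measurable [measurable]: "proj_grad t \<in> borel_measurable borel"
  using borel_measurable_cond_exp2 unfolding proj_grad_def measurable_P_iff[symmetric] .

lemma proj_grad_powr_integrable: "integrable P (\<lambda>x. \<bar>proj_grad t x\<bar> powr q)"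
  unfolding proj_grad_def using pqD(2) G_powr_integrable
  by (intro integrable_real_cond_exp_powr prob_space_axioms subalgebra_past) (auto simp: measurable_P_iff)

lemma sens_nonneg: "0 \<le> sens"
  by (simp add: sens_def)

lemma sens_powr: "(\<Sum>t\<in>UNIV. \<integral>x. \<bar>proj_grad t x\<bar> powr q \<partial>P) = sens powr q"
  using pqD(2) by (simp add: sens_def powr_powr sum_nonneg)

lemma integral_mult_proj_grad:
  assumes "u \<in> borel_measurable (process_algebra (\<lambda>x. x) {..t})" "integrable P (\<lambda>x. \<bar>u x\<bar> powr p)"
  shows "(\<integral>x. G x $ t * u x \<partial>P) = (\<integral>x. proj_grad t x * u x \<partial>P)"
proof -
  interpret F: sigma_finite_subalgebra P "process_algebra (\<lambda>x. x) {..t}"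
    by (intro prob_space_subalgebra prob_space_axioms subalgebra_past)
  have u: "u \<in> borel_measurable P" using subalgebra_past assms(1) by (rule measurable_from_subalg)
  have "(\<integral>x. u x * proj_grad t x \<partial>P) = (\<integral>x. u x * (G x $ t) \<partial>P)" unfolding proj_grad_def
  proof (rule F.real_cond_exp_intg(2)[OF _ assms(1)])
    have "integrable P (\<lambda>x. G x $ t * u x)"
      using assms G_powr_integrable u by (intro integrable_mult_conjugate[OF pq]) (auto simp: measurable_P_iff)
    then show "integrable P (\<lambda>x. u x * (G x $ t))" by (simp add: mult.commute)
  qed (simp add: measurable_P_iff)
  then show ?thesis by (simp add: mult.commute)
qed

lemma expansion:
  assumes "0 < e"
  shows "\<exists>r0>0. \<forall>Q\<in>finite_moment_measures p. \<forall>\<pi>\<in>couplings P Q. \<forall>r. 0 < r \<longrightarrow> r < r0 \<longrightarrow>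
    (\<Sum>t\<in>UNIV. \<integral>\<omega>. \<bar>fst \<omega> $ t - snd \<omega> $ t\<bar> powr p \<partial>\<pi>) \<le> r powr p \<longrightarrow>
    \<bar>(\<integral>x. f x \<partial>Q) - (\<integral>x. f x \<partial>P) - (\<Sum>t\<in>UNIV. \<integral>\<omega>. G (fst \<omega>) $ t * (snd \<omega> $ t - fst \<omega> $ t) \<partial>\<pi>)\<bar> \<le> e * r"
  by (rule first_order_expansion[OF der cont pq C growth P assms])

text \<open>Causality replaces the gradient by its projections on the past, and Hoelder's inequality
  bounds the first order term.\<close>

lemma causal_first_order_le:
  assumes Q: "Q \<in> finite_moment_measures p" and \<pi>: "\<pi> \<in> couplings P Q" and causal: "causal \<pi> fst snd"
    and A: "sens < A" and B: "0 < B"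
    and cost: "(\<Sum>t\<in>UNIV. \<integral>\<omega>. \<bar>fst \<omega> $ t - snd \<omega> $ t\<bar> powr p \<partial>\<pi>) \<le> B powr p"
  shows "(\<Sum>t\<in>UNIV. \<integral>\<omega>. G (fst \<omega>) $ t * (snd \<omega> $ t - fst \<omega> $ t) \<partial>\<pi>) \<le> A * B"
proof -
  note \<pi>D = couplingsD[OF \<pi>]
  have p0: "0 < p" using pqD(1) by simp
  note mom = coupling_moments[OF P Q \<pi> p0]
  note [measurable] = \<pi>D(6,7)
  have transfer: "integrable P k \<Longrightarrow> integrable \<pi> (\<lambda>\<omega>. k (fst \<omega>))" "(\<integral>\<omega>. k (fst \<omega>) \<partial>\<pi>) = (\<integral>x. k x \<partial>P)"
    if "k \<in> borel_measurable borel" for k :: "_ \<Rightarrow> real"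
    using integrable_distr_eq[OF \<pi>D(6) that] integral_distr[OF \<pi>D(6) that] by (simp_all add: \<pi>D(4))
  have Gq: "integrable \<pi> (\<lambda>\<omega>. \<bar>G (fst \<omega>) $ t\<bar> powr q)" for t
    by (rule transfer(1)[OF _ G_powr_integrable]) measurable
  have Hq: "integrable \<pi> (\<lambda>\<omega>. \<bar>proj_grad t (fst \<omega>)\<bar> powr q)" for t
    by (rule transfer(1)[OF _ proj_grad_powr_integrable]) measurable
  have Hqe: "(\<integral>\<omega>. \<bar>proj_grad t (fst \<omega>)\<bar> powr q \<partial>\<pi>) = (\<integral>x. \<bar>proj_grad t x\<bar> powr q \<partial>P)" for t
    by (rule transfer(2)) measurable
  have id: "adapted_map (\<lambda>x :: (real, 'n) vec. x)" by (auto simp: adapted_map_def)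
  \<comment> \<open>Causality with \<open>Y = X\<close> is trivial and takes care of the increment's second term \<open>X\<^sub>t\<close>.\<close>
  have causal': "causal \<pi> fst fst"
    by (rule causal_adapted_map[OF \<pi>D(1,3) _ _ id]) auto
  have "(\<integral>\<omega>. G (fst \<omega>) $ t * (snd \<omega> $ t - fst \<omega> $ t) \<partial>\<pi>) = (\<integral>\<omega>. proj_grad t (fst \<omega>) * (snd \<omega> $ t - fst \<omega> $ t) \<partial>\<pi>)" for t
  proof -
    have *: "(\<integral>\<omega>. G (fst \<omega>) $ t * Y \<omega> $ t \<partial>\<pi>) = (\<integral>\<omega>. proj_grad t (fst \<omega>) * Y \<omega> $ t \<partial>\<pi>)"
      "integrable \<pi> (\<lambda>\<omega>. G (fst \<omega>) $ t * Y \<omega> $ t)" "integrable \<pi> (\<lambda>\<omega>. proj_grad t (fst \<omega>) * Y \<omega> $ t)"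
      if Y: "causal \<pi> fst Y" "integrable \<pi> (\<lambda>\<omega>. \<bar>Y \<omega> $ t\<bar> powr p)" and [measurable]: "Y \<in> borel_measurable \<pi>" for Y
    proof -
      show "(\<integral>\<omega>. G (fst \<omega>) $ t * Y \<omega> $ t \<partial>\<pi>) = (\<integral>\<omega>. proj_grad t (fst \<omega>) * Y \<omega> $ t \<partial>\<pi>)"
        using causal_integral[OF \<pi>D(1,3,6) that(3) Y(1) pq, of "\<lambda>x. G x $ t" t] G_powr_integrable[of t] Y(2)
        by (simp add: \<pi>D(4) proj_grad_def)
      show "integrable \<pi> (\<lambda>\<omega>. G (fst \<omega>) $ t * Y \<omega> $ t)" "integrable \<pi> (\<lambda>\<omega>. proj_grad t (fst \<omega>) * Y \<omega> $ t)"
        by (auto intro!: integrable_mult_conjugate[OF pq] Gq Hq Y)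
    qed
    show ?thesis
      using *[OF causal mom(4)] *[OF causal' mom(3)] by (simp add: right_diff_distrib)
  qed
  then have "(\<Sum>t\<in>UNIV. \<integral>\<omega>. G (fst \<omega>) $ t * (snd \<omega> $ t - fst \<omega> $ t) \<partial>\<pi>)
      \<le> (\<Sum>t\<in>UNIV. \<integral>\<omega>. \<bar>proj_grad t (fst \<omega>) * (snd \<omega> $ t - fst \<omega> $ t)\<bar> \<partial>\<pi>)"
    using mom(2) Hq
    by (auto intro!: sum_mono integral_mono integrable_abs integrable_mult_conjugate[OF pq])
  also have "\<dots> \<le> A * B"
  proof (rule Hoelder_sum_integral[OF pq])
    show "(\<Sum>t\<in>UNIV. \<integral>\<omega>. \<bar>proj_grad t (fst \<omega>)\<bar> powr q \<partial>\<pi>) \<le> A powr q"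
      unfolding Hqe sens_powr using A sens_nonneg pqD(2) by (intro powr_mono2) auto
    show "(\<Sum>t\<in>UNIV. \<integral>\<omega>. \<bar>snd \<omega> $ t - fst \<omega> $ t\<bar> powr p \<partial>\<pi>) \<le> B powr p"
      using cost by (simp add: abs_minus_commute)
  qed (use mom(2) Hq A sens_nonneg B in auto)
  finally show ?thesis .
qed

proposition upper_bound:
  assumes e: "0 < e"
  shows "\<exists>r1>0. \<forall>r. 0 < r \<longrightarrow> r < r1 \<longrightarrow> (\<forall>Q\<in>adapted_ball p P r. (\<integral>x. f x \<partial>Q) \<le> (\<integral>x. f x \<partial>P) + r * (sens + e))"
proof -
  \<comment> \<open>The infimum need not be attained; there is a bicausal coupling of cost below \<open>k r\<close>, and \<open>k > 1\<close>
    is chosen so that this loss, the error of the expansion and the slack in Hoelder's inequality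
    together amount to \<open>e r\<close>.\<close>
  define k where "k = (sens + e) / (sens + e / 2)"
  have k: "1 < k" "(sens + e / 2) * k = sens + e" using e sens_nonneg by (auto simp: k_def field_simps)
  obtain r0 where r0: "0 < r0" "\<And>Q \<pi> r. Q \<in> finite_moment_measures p \<Longrightarrow> \<pi> \<in> couplings P Q \<Longrightarrow> 0 < r \<Longrightarrow> r < r0 \<Longrightarrow>
    (\<Sum>t\<in>UNIV. \<integral>\<omega>. \<bar>fst \<omega> $ t - snd \<omega> $ t\<bar> powr p \<partial>\<pi>) \<le> r powr p \<Longrightarrow>
    \<bar>(\<integral>x. f x \<partial>Q) - (\<integral>x. f x \<partial>P) - (\<Sum>t\<in>UNIV. \<integral>\<omega>. G (fst \<omega>) $ t * (snd \<omega> $ t - fst \<omega> $ t) \<partial>\<pi>)\<bar> \<le> (e / 4) * r"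
    using expansion[of "e / 4"] e by auto
  have "(\<integral>x. f x \<partial>Q) \<le> (\<integral>x. f x \<partial>P) + r * (sens + e)" if r: "0 < r" "r < r0 / k" and Q: "Q \<in> adapted_ball p P r" for r Q
  proof -
    let ?cost = "\<lambda>\<pi>. \<Sum>t\<in>UNIV. \<integral>\<omega>. \<bar>fst \<omega> $ t - snd \<omega> $ t\<bar> powr p \<partial>(\<pi> :: ((real, 'n) vec \<times> (real, 'n) vec) measure)"
    have Qm: "Q \<in> finite_moment_measures p" and aw: "adapted_wasserstein p P Q \<le> r"
      using Q by (auto simp: adapted_ball_def)
    have kr: "r < k * r" "0 < k * r" "k * r < r0" using r k by (auto simp: field_simps)
    have "(INF \<pi>\<in>bicausal_couplings P Q. ?cost \<pi> powr (1 / p)) < k * r"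
      using aw kr unfolding adapted_wasserstein_def by linarith
    moreover have "bicausal_couplings P Q \<noteq> {}"
      using bicausal_couplings_nonempty[OF PD(1,2) finite_moment_measuresD(1,2)[OF Qm]] by blast
    ultimately obtain \<pi> where \<pi>: "\<pi> \<in> bicausal_couplings P Q" "?cost \<pi> powr (1 / p) < k * r"
      using cInf_lessD[of "(\<lambda>\<pi>. ?cost \<pi> powr (1 / p)) ` bicausal_couplings P Q" "k * r"] by auto
    have \<pi>c: "\<pi> \<in> couplings P Q" "causal \<pi> fst snd" using \<pi> by (auto simp: bicausal_couplings_def)
    have "(?cost \<pi> powr (1 / p)) powr p \<le> (k * r) powr p"
      using \<pi>(2) pqD(1) by (intro powr_mono2) auto
    then have cost: "?cost \<pi> \<le> (k * r) powr p"
      using pqD(1) by (simp add: powr_powr sum_nonneg)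
    have "(\<Sum>t\<in>UNIV. \<integral>\<omega>. G (fst \<omega>) $ t * (snd \<omega> $ t - fst \<omega> $ t) \<partial>\<pi>) \<le> (sens + e / 4) * (k * r)"
      using e kr by (intro causal_first_order_le[OF Qm \<pi>c _ _ cost]) auto
    then have "(\<integral>x. f x \<partial>Q) - (\<integral>x. f x \<partial>P) \<le> (sens + e / 4) * (k * r) + (e / 4) * (k * r)"
      using r0(2)[OF Qm \<pi>c(1) kr(2,3) cost] by linarith
    also have "\<dots> = ((sens + e / 2) * k) * r" by (simp add: algebra_simps)
    also have "\<dots> = r * (sens + e)" unfolding k by simp
    finally show ?thesis by simp
  qed
  then show ?thesis using r0(1) k by (intro exI[of _ "r0 / k"]) auto
qed

text \<open>Adapted Lipschitz directions of norm at most one come arbitrarily close to equality in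
  Hoelder's inequality against the projected gradient.\<close>

lemma optimal_direction:
  assumes e: "0 < e"
  shows "\<exists>\<phi>. (\<forall>t. \<phi> t \<in> test_functions {..t}) \<and> (\<Sum>t\<in>UNIV. \<integral>x. \<bar>\<phi> t x\<bar> powr p \<partial>P) \<le> 1 \<and>
    sens - e \<le> (\<Sum>t\<in>UNIV. \<integral>x. G x $ t * \<phi> t x \<partial>P)"
proof (cases "sens = 0")
  case True
  then show ?thesis using e
    by (intro exI[of _ "\<lambda>t x. 0"]) (auto simp: test_functions_const)
next
  case False
  then have sens: "0 < sens" using sens_nonneg by simp
  define l where "l = min (1 / 2) (e / (2 * sens))"
  have l: "0 < l" "l < 1" using e sens by (auto simp: l_def)
  have lV: "2 * (l * sens) \<le> e"
  proof -
    have "2 * (l * sens) \<le> 2 * ((e / (2 * sens)) * sens)" using sens by (intro mult_left_mono mult_right_mono) (auto simp: l_def)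
    then show ?thesis using sens by simp
  qed
  \<comment> \<open>\<open>Z\<close> has norm one and attains equality. Test functions within \<open>l\<close> of \<open>(1 - l) Z\<close> have norm at
    most one, by convexity of \<open>y \<mapsto> \<bar>y\<bar>\<^sup>p\<close>, and lose at most \<open>2 l\<close> times the optimal value.\<close>
  define Z where "Z t x = sgn (proj_grad t x) * \<bar>proj_grad t x\<bar> powr (q - 1) / sens powr (q - 1)" for t x
  have Z_past: "Z t \<in> borel_measurable (process_algebra (\<lambda>x. x) {..t})" for t
    using proj_grad_measurable_past[of t] unfolding Z_def[abs_def] by measurable
  have Z_meas[measurable]: "Z t \<in> borel_measurable borel" for t unfolding Z_def[abs_def] by measurable
  have Zp: "\<bar>Z t x\<bar> powr p = \<bar>proj_grad t x\<bar> powr q / sens powr q" for t x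
  proof (cases "proj_grad t x = 0")
    case False
    then have "\<bar>Z t x\<bar> = \<bar>proj_grad t x\<bar> powr (q - 1) / sens powr (q - 1)" by (simp add: Z_def abs_mult abs_sgn_eq)
    then show ?thesis using pqD(4) by (simp add: powr_divide powr_powr)
  qed (use pqD(1,2) in \<open>simp add: Z_def\<close>)
  have Z_int: "integrable P (\<lambda>x. \<bar>Z t x\<bar> powr p)" for t
    using proj_grad_powr_integrable by (simp add: Zp)
  have Z_sum: "(\<Sum>t\<in>UNIV. \<integral>x. \<bar>Z t x\<bar> powr p \<partial>P) = 1"
    using sens sens_powr by (simp add: Zp flip: sum_divide_distrib)
  have HZ: "proj_grad t x * Z t x = \<bar>proj_grad t x\<bar> powr q / sens powr (q - 1)" for t x
  proof -
    have "proj_grad t x * sgn (proj_grad t x) * \<bar>proj_grad t x\<bar> powr (q - 1) = \<bar>proj_grad t x\<bar> powr q"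
      using powr_add[of "\<bar>proj_grad t x\<bar>" 1 "q - 1"] by (simp add: abs_sgn[symmetric])
    then show ?thesis by (simp add: Z_def)
  qed
  have HZ_sum: "(\<Sum>t\<in>UNIV. \<integral>x. proj_grad t x * Z t x \<partial>P) = sens"
  proof -
    have "(\<Sum>t\<in>UNIV. \<integral>x. proj_grad t x * Z t x \<partial>P) = sens powr q / sens powr (q - 1)"
      by (simp add: HZ sens_powr flip: sum_divide_distrib)
    also have "\<dots> = sens" using sens by (simp flip: powr_diff)
    finally show ?thesis .
  qed
  have d: "0 < l powr p / real CARD('n)" using l by simp
  have "\<forall>t. \<exists>\<phi>. \<phi> \<in> test_functions {..t} \<and> (\<integral>x. \<bar>(1 - l) * Z t x - \<phi> x\<bar> powr p \<partial>P) \<le> l powr p / real CARD('n)"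
  proof
    fix t
    have "integrable P (\<lambda>x. \<bar>1 - l\<bar> powr p * \<bar>Z t x\<bar> powr p)" using Z_int by auto
    then have "Lp_approximable P p {..t} (\<lambda>x. (1 - l) * Z t x)"
      using PD Z_past[of t] pqD(1)
      by (intro test_functions_dense) (auto simp: abs_mult powr_mult intro: borel_measurable_times)
    then show "\<exists>\<phi>. \<phi> \<in> test_functions {..t} \<and> (\<integral>x. \<bar>(1 - l) * Z t x - \<phi> x\<bar> powr p \<partial>P) \<le> l powr p / real CARD('n)"
      using d unfolding Lp_approximable_def by blast
  qed
  from choice[OF this] obtain \<phi> where \<phi>: "\<And>t. \<phi> t \<in> test_functions {..t}"
    "\<And>t. (\<integral>x. \<bar>(1 - l) * Z t x - \<phi> t x\<bar> powr p \<partial>P) \<le> l powr p / real CARD('n)" by blast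
  define E where "E t x = (1 - l) * Z t x - \<phi> t x" for t x
  have \<phi>_meas[measurable]: "\<phi> t \<in> borel_measurable borel" for t by (rule test_functions_measurable[OF \<phi>(1)])
  have E_meas[measurable]: "E t \<in> borel_measurable borel" for t unfolding E_def[abs_def] by measurable
  have \<phi>_int: "integrable P (\<lambda>x. \<bar>\<phi> t x\<bar> powr p)" for t
    using PD pqD(1) by (intro test_functions_powr_integrable[OF _ _ _ \<phi>(1)]) auto
  have E_int: "integrable P (\<lambda>x. \<bar>E t x\<bar> powr p)" for t
  proof -
    have "integrable P (\<lambda>x. \<bar>1 - l\<bar> powr p * \<bar>Z t x\<bar> powr p)" using Z_int by auto
    then show ?thesis unfolding E_def using PD pqD(1)
      by (intro test_functions_error_integrable[OF _ _ _ \<phi>(1)]) (auto simp: abs_mult powr_mult measurable_P_iff)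
  qed
  have E_sum: "(\<Sum>t\<in>UNIV. \<integral>x. \<bar>E t x\<bar> powr p \<partial>P) \<le> l powr p"
    using sum_mono[of UNIV "\<lambda>t. \<integral>x. \<bar>E t x\<bar> powr p \<partial>P" "\<lambda>t. l powr p / real CARD('n)"] \<phi>(2)
    by (simp add: E_def)
  have "(\<Sum>t\<in>UNIV. \<integral>x. \<bar>\<phi> t x\<bar> powr p \<partial>P)
      \<le> (\<Sum>t\<in>UNIV. \<integral>x. (1 - l) * \<bar>Z t x\<bar> powr p + l * (\<bar>E t x\<bar> powr p / l powr p) \<partial>P)"
  proof (intro sum_mono integral_mono \<phi>_int)
    fix t x
    have "\<bar>\<phi> t x\<bar> \<le> (1 - l) * \<bar>Z t x\<bar> + l * (\<bar>E t x\<bar> / l)"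
      using l abs_triangle_ineq4[of "(1 - l) * Z t x" "E t x"] by (simp add: E_def abs_mult)
    then have "\<bar>\<phi> t x\<bar> powr p \<le> ((1 - l) * \<bar>Z t x\<bar> + l * (\<bar>E t x\<bar> / l)) powr p"
      using pqD(1) by (intro powr_mono2) auto
    also have "\<dots> \<le> (1 - l) * \<bar>Z t x\<bar> powr p + l * (\<bar>E t x\<bar> / l) powr p"
      using pqD(1) l by (intro powr_convex_combination) auto
    finally show "\<bar>\<phi> t x\<bar> powr p \<le> (1 - l) * \<bar>Z t x\<bar> powr p + l * (\<bar>E t x\<bar> powr p / l powr p)"
      using l by (simp add: powr_divide)
  qed (use Z_int E_int in auto)
  also have "\<dots> = (1 - l) * (\<Sum>t\<in>UNIV. \<integral>x. \<bar>Z t x\<bar> powr p \<partial>P)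
      + l * ((\<Sum>t\<in>UNIV. \<integral>x. \<bar>E t x\<bar> powr p \<partial>P) / l powr p)"
    using Z_int E_int by (simp add: sum.distrib sum_distrib_left sum_divide_distrib)
  also have "\<dots> \<le> (1 - l) * 1 + l * 1"
    using E_sum l by (intro add_mono mult_left_mono) (auto simp: Z_sum)
  finally have cost: "(\<Sum>t\<in>UNIV. \<integral>x. \<bar>\<phi> t x\<bar> powr p \<partial>P) \<le> 1" by simp
  have HE: "(\<Sum>t\<in>UNIV. \<integral>x. \<bar>proj_grad t x * E t x\<bar> \<partial>P) \<le> sens * l"
    using sens l E_sum sens_powr proj_grad_powr_integrable E_int
    by (intro Hoelder_sum_integral[OF pq]) (auto simp: measurable_P_iff)
  have HE_int: "integrable P (\<lambda>x. proj_grad t x * E t x)" and HZ_int: "integrable P (\<lambda>x. proj_grad t x * Z t x)" for t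
    using proj_grad_powr_integrable E_int Z_int by (auto intro!: integrable_mult_conjugate[OF pq] simp: measurable_P_iff)
  have "(\<integral>x. G x $ t * \<phi> t x \<partial>P) \<ge> (1 - l) * (\<integral>x. proj_grad t x * Z t x \<partial>P) - (\<integral>x. \<bar>proj_grad t x * E t x\<bar> \<partial>P)" for t
  proof -
    have "(\<integral>x. G x $ t * \<phi> t x \<partial>P) = (\<integral>x. proj_grad t x * \<phi> t x \<partial>P)"
      by (intro integral_mult_proj_grad \<phi>_int measurable_process_algebra_continuous test_functions_continuous[OF \<phi>(1)]
            test_functions_cong[OF \<phi>(1)])
    also have "\<dots> = (\<integral>x. (1 - l) * (proj_grad t x * Z t x) - proj_grad t x * E t x \<partial>P)"
      by (simp add: E_def algebra_simps)
    also have "\<dots> = (1 - l) * (\<integral>x. proj_grad t x * Z t x \<partial>P) - (\<integral>x. proj_grad t x * E t x \<partial>P)"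
      using HE_int HZ_int by simp
    finally have eq: "(\<integral>x. G x $ t * \<phi> t x \<partial>P) = (1 - l) * (\<integral>x. proj_grad t x * Z t x \<partial>P) - (\<integral>x. proj_grad t x * E t x \<partial>P)" .
    have "(\<integral>x. proj_grad t x * E t x \<partial>P) \<le> (\<integral>x. \<bar>proj_grad t x * E t x\<bar> \<partial>P)"
      using HE_int by (intro integral_mono integrable_abs) auto
    then show ?thesis using eq by linarith
  qed
  then have "(\<Sum>t\<in>UNIV. (1 - l) * (\<integral>x. proj_grad t x * Z t x \<partial>P) - (\<integral>x. \<bar>proj_grad t x * E t x\<bar> \<partial>P))
      \<le> (\<Sum>t\<in>UNIV. \<integral>x. G x $ t * \<phi> t x \<partial>P)" by (intro sum_mono)
  then have "(1 - l) * sens - (\<Sum>t\<in>UNIV. \<integral>x. \<bar>proj_grad t x * E t x\<bar> \<partial>P) \<le> (\<Sum>t\<in>UNIV. \<integral>x. G x $ t * \<phi> t x \<partial>P)"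
    by (simp add: sum_subtractf HZ_sum flip: sum_distrib_left)
  then have "sens - e \<le> (\<Sum>t\<in>UNIV. \<integral>x. G x $ t * \<phi> t x \<partial>P)" using HE lV by (simp add: algebra_simps)
  then show ?thesis using \<phi>(1) cost by blast
qed

text \<open>The competitor is the law of \<open>X + r \<phi>(X)\<close> for such a direction \<open>\<phi>\<close>. Since \<open>\<phi>\<close> is Lipschitz, the
  map is invertible with adapted inverse for small \<open>r\<close>, so that its cost bounds the adapted
  distance.\<close>

proposition lower_bound:
  assumes e: "0 < e"
  shows "\<exists>r1>0. \<forall>r. 0 < r \<longrightarrow> r < r1 \<longrightarrow> (\<exists>Q\<in>adapted_ball p P r. (\<integral>x. f x \<partial>P) + r * (sens - e) \<le> (\<integral>x. f x \<partial>Q))"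
proof -
  have e2: "0 < e / 2" using e by simp
  obtain \<phi> where \<phi>: "\<And>t. \<phi> t \<in> test_functions {..t}" and \<phi>_cost: "(\<Sum>t\<in>UNIV. \<integral>x. \<bar>\<phi> t x\<bar> powr p \<partial>P) \<le> 1"
    and \<phi>_gain: "sens - e / 2 \<le> (\<Sum>t\<in>UNIV. \<integral>x. G x $ t * \<phi> t x \<partial>P)"
    using optimal_direction[OF e2] by blast
  define \<Psi> where "\<Psi> r x = x + r *\<^sub>R (\<chi> t. \<phi> t x)" for r x
  obtain r1 where r1: "0 < r1" "\<And>r. 0 < r \<Longrightarrow> r < r1 \<Longrightarrow> \<exists>\<Theta>. adapted_map \<Theta> \<and> (\<forall>x. \<Theta> (\<Psi> r x) = x)"
    using test_functions_perturbation_invertible[OF \<phi>] unfolding \<Psi>_def by blast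
  obtain r0 where r0: "0 < r0" "\<And>Q \<pi> r. Q \<in> finite_moment_measures p \<Longrightarrow> \<pi> \<in> couplings P Q \<Longrightarrow> 0 < r \<Longrightarrow> r < r0 \<Longrightarrow>
    (\<Sum>t\<in>UNIV. \<integral>\<omega>. \<bar>fst \<omega> $ t - snd \<omega> $ t\<bar> powr p \<partial>\<pi>) \<le> r powr p \<Longrightarrow>
    \<bar>(\<integral>x. f x \<partial>Q) - (\<integral>x. f x \<partial>P) - (\<Sum>t\<in>UNIV. \<integral>\<omega>. G (fst \<omega>) $ t * (snd \<omega> $ t - fst \<omega> $ t) \<partial>\<pi>)\<bar> \<le> e / 2 * r"
    using expansion[OF e2] by auto
  have p0: "0 < p" using pqD(1) by simp
  have \<phi>_meas[measurable]: "\<phi> t \<in> borel_measurable borel" for t by (rule test_functions_measurable[OF \<phi>])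
  have \<phi>_int: "integrable P (\<lambda>x. \<bar>\<phi> t x\<bar> powr p)" for t
    using PD pqD(1) by (intro test_functions_powr_integrable[OF _ _ _ \<phi>]) auto
  have "\<exists>Q\<in>adapted_ball p P r. (\<integral>x. f x \<partial>P) + r * (sens - e) \<le> (\<integral>x. f x \<partial>Q)"
    if r: "0 < r" "r < min r0 r1" for r
  proof -
    have \<Psi>: "adapted_map (\<Psi> r)" unfolding \<Psi>_def by (rule test_functions_perturbation_adapted[OF \<phi>])
    obtain \<Theta> where \<Theta>: "adapted_map \<Theta>" "\<And>x. \<Theta> (\<Psi> r x) = x" using r1(2) r by auto
    have \<Psi>_meas[measurable]: "\<Psi> r \<in> borel_measurable borel" by (rule adapted_map_measurable[OF \<Psi>])
    have \<Psi>_meas_P: "\<Psi> r \<in> borel_measurable P" by (simp add: measurable_P_iff)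
    define Q where "Q = distr P borel (\<Psi> r)"
    define \<pi> where "\<pi> = distr P borel (\<lambda>x. (x, \<Psi> r x))"
    have \<pi>: "\<pi> \<in> bicausal_couplings P Q"
      unfolding \<pi>_def Q_def by (rule bicausal_coupling_adapted_map[OF PD(1,2) \<Psi> \<Theta>])
    then have \<pi>c: "\<pi> \<in> couplings P Q" by (auto simp: bicausal_couplings_def)
    note \<pi>D = couplingsD[OF \<pi>c]
    have pair_meas: "(\<lambda>x. (x, \<Psi> r x)) \<in> measurable P borel"
      using \<Psi>_meas unfolding borel_prod[symmetric] by (simp add: measurable_P_iff measurable_cong_sets[OF PD(2) refl])
    have \<pi>_int: "(\<integral>\<omega>. k \<omega> \<partial>\<pi>) = (\<integral>x. k (x, \<Psi> r x) \<partial>P)" if "k \<in> borel_measurable \<pi>" for k :: "_ \<Rightarrow> real"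
      using that pair_meas unfolding \<pi>_def by (simp add: integral_distr)
    have Qm: "Q \<in> finite_moment_measures p"
    proof -
      let ?n = "\<lambda>x. norm (r *\<^sub>R (\<chi> t. \<phi> t x))"
      have vec: "(\<lambda>x. r *\<^sub>R (\<chi> t. \<phi> t x)) \<in> borel_measurable borel"
        by (intro borel_measurable_continuous_onI continuous_intros continuous_on_vec_lambda test_functions_continuous[OF \<phi>])
      have n: "integrable P (\<lambda>x. \<bar>?n x\<bar> powr p)"
      proof (rule Bochner_Integration.integrable_bound)
        show "integrable P (\<lambda>x. r powr p * (real CARD('n) powr p * (\<Sum>t\<in>UNIV. \<bar>\<phi> t x\<bar> powr p)))"
          using \<phi>_int by auto
        show "(\<lambda>x. \<bar>?n x\<bar> powr p) \<in> borel_measurable P" using vec unfolding measurable_P_iff by measurable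
        have "\<bar>?n x\<bar> powr p \<le> r powr p * (real CARD('n) powr p * (\<Sum>t\<in>UNIV. \<bar>\<phi> t x\<bar> powr p))" for x
          using norm_powr_le_sum[OF p0, of "\<chi> t. \<phi> t x"] r by (simp add: powr_mult mult_left_mono)
        then show "AE x in P. norm (\<bar>?n x\<bar> powr p) \<le> norm (r powr p * (real CARD('n) powr p * (\<Sum>t\<in>UNIV. \<bar>\<phi> t x\<bar> powr p)))"
          by (intro AE_I2) (auto intro: order_trans[OF _ abs_ge_self])
      qed
      have n_meas: "?n \<in> borel_measurable P" using vec unfolding measurable_P_iff by measurable
      have "integrable P (\<lambda>x. \<bar>norm x + ?n x\<bar> powr p)"
        by (rule integral_add_powr_le(1)[OF _ n_meas _ n p0]) (use PD(4) in \<open>simp_all add: measurable_P_iff\<close>)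
      then have "integrable P (\<lambda>x. norm (\<Psi> r x) powr p)"
      proof (rule Bochner_Integration.integrable_bound)
        have "norm (\<Psi> r x) powr p \<le> \<bar>norm x + ?n x\<bar> powr p" for x
          using p0 unfolding \<Psi>_def
          by (intro powr_mono2) (auto intro: order_trans[OF norm_triangle_ineq])
        then show "AE x in P. norm (norm (\<Psi> r x) powr p) \<le> norm (\<bar>norm x + ?n x\<bar> powr p)"
          by (intro AE_I2) auto
      qed (simp add: measurable_P_iff)
      then show ?thesis unfolding finite_moment_measures_def Q_def
        using \<Psi>_meas_P by (auto simp: integrable_distr_eq intro: prob_space_distr)
    qed
    have [measurable]: "fst \<in> borel_measurable \<pi>" "snd \<in> borel_measurable \<pi>" by (rule \<pi>D)+
    have cost: "(\<Sum>t\<in>UNIV. \<integral>\<omega>. \<bar>fst \<omega> $ t - snd \<omega> $ t\<bar> powr p \<partial>\<pi>) \<le> r powr p"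
    proof -
      have "(\<Sum>t\<in>UNIV. \<integral>\<omega>. \<bar>fst \<omega> $ t - snd \<omega> $ t\<bar> powr p \<partial>\<pi>) = (\<Sum>t\<in>UNIV. \<integral>x. r powr p * \<bar>\<phi> t x\<bar> powr p \<partial>P)"
        using r by (subst \<pi>_int) (auto simp: \<Psi>_def abs_mult powr_mult)
      also have "\<dots> = r powr p * (\<Sum>t\<in>UNIV. \<integral>x. \<bar>\<phi> t x\<bar> powr p \<partial>P)"
        by (simp add: sum_distrib_left)
      also have "\<dots> \<le> r powr p * 1" using \<phi>_cost by (intro mult_left_mono) auto
      finally show ?thesis by simp
    qed
    have "adapted_wasserstein p P Q \<le> (\<Sum>t\<in>UNIV. \<integral>\<omega>. \<bar>fst \<omega> $ t - snd \<omega> $ t\<bar> powr p \<partial>\<pi>) powr (1 / p)"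
      unfolding adapted_wasserstein_def by (rule cINF_lower[OF _ \<pi>]) (auto intro!: bdd_belowI[of _ 0])
    also have "\<dots> \<le> (r powr p) powr (1 / p)"
      using cost p0 by (intro powr_mono2) (auto intro: sum_nonneg)
    also have "\<dots> = r" using r p0 by (simp add: powr_powr)
    finally have ball: "Q \<in> adapted_ball p P r" using Qm by (simp add: adapted_ball_def)
    have "(\<Sum>t\<in>UNIV. \<integral>\<omega>. G (fst \<omega>) $ t * (snd \<omega> $ t - fst \<omega> $ t) \<partial>\<pi>) = r * (\<Sum>t\<in>UNIV. \<integral>x. G x $ t * \<phi> t x \<partial>P)"
    proof -
      have "(\<Sum>t\<in>UNIV. \<integral>\<omega>. G (fst \<omega>) $ t * (snd \<omega> $ t - fst \<omega> $ t) \<partial>\<pi>)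
          = (\<Sum>t\<in>UNIV. \<integral>x. r * (G x $ t * \<phi> t x) \<partial>P)"
        by (subst \<pi>_int) (auto simp: \<Psi>_def algebra_simps)
      then show ?thesis by (simp add: sum_distrib_left)
    qed
    moreover have "r * (sens - e / 2) \<le> r * (\<Sum>t\<in>UNIV. \<integral>x. G x $ t * \<phi> t x \<partial>P)"
      using \<phi>_gain r by (intro mult_left_mono) auto
    moreover have "\<bar>(\<integral>x. f x \<partial>Q) - (\<integral>x. f x \<partial>P)
        - (\<Sum>t\<in>UNIV. \<integral>\<omega>. G (fst \<omega>) $ t * (snd \<omega> $ t - fst \<omega> $ t) \<partial>\<pi>)\<bar> \<le> e / 2 * r"
      using r by (intro r0(2)[OF Qm \<pi>c _ _ cost]) auto
    ultimately have "(\<integral>x. f x \<partial>P) + (r * (sens - e / 2) - e / 2 * r) \<le> (\<integral>x. f x \<partial>Q)"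
      by linarith
    also have "r * (sens - e / 2) - e / 2 * r = r * (sens - e)" by (simp add: field_simps)
    finally show ?thesis using ball by blast
  qed
  then show ?thesis using r0(1) r1(1) by (intro exI[of _ "min r0 r1"]) auto
qed

end

theorem theorem2p2:
  fixes p q c :: real
    and P :: "(real ^ 'n::{finite,linorder}) measure"
    and f :: "real ^ 'n::{finite,linorder} \<Rightarrow> real"
  assumes "1 < p" and "q = p / (p - 1)"
    and "P \<in> finite_moment_measures p"
    and "continuously_differentiable f"
    and "c > 0"
    and "\<And>x. (\<Sum>s\<in>UNIV. \<bar>partial_deriv s f x\<bar>) \<le> c * (1 + (\<Sum>s\<in>UNIV. \<bar>x $ s\<bar> powr (p - 1)))"
  shows "\<exists>R. R \<in> o[at_right 0](\<lambda>r::real. r) \<and>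
    (\<forall>\<^sub>F r in at_right 0.
       (SUP Q\<in>adapted_ball p P r. ereal (\<integral>x. f x \<partial>Q))
       = ereal ((\<integral>x. f x \<partial>P)
           + r * (\<Sum>t\<in>UNIV. \<integral>x. \<bar>real_cond_exp P (process_algebra (\<lambda>x. x) {..t}) (partial_deriv t f) x\<bar> powr q \<partial>P)
                   powr (1 / q)
           + R r))"
proof -
  have growth: "norm (gradient f x) \<le> c * (1 + real CARD('n)) * (1 + norm x powr (p - 1))" for x
  proof -
    have "norm (gradient f x) \<le> (\<Sum>s\<in>UNIV. \<bar>partial_deriv s f x\<bar>)"
      using norm_le_l1_cart[of "gradient f x"] by simp
    also have "\<dots> \<le> c * (1 + real CARD('n) * norm x powr (p - 1))"
      using assms(1,5) sum_powr_le_norm[of "p - 1" x]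
      by (intro order_trans[OF assms(6)] mult_left_mono) auto
    also have "\<dots> \<le> c * ((1 + real CARD('n)) * (1 + norm x powr (p - 1)))"
      using assms(5) by (intro mult_left_mono) (auto simp: algebra_simps)
    finally show ?thesis by (simp add: mult.assoc)
  qed
  interpret D: differentiable_growth p q "c * (1 + real CARD('n))" f "gradient f" P
    using assms(1-5) growth continuously_differentiable_gradient[OF assms(4)]
    by unfold_locales (auto simp: conjugate_exponents_def)
  have pd: "(\<lambda>x. gradient f x $ t) = partial_deriv t f" for t by (simp add: fun_eq_iff)
  define S where "S r = (SUP Q\<in>adapted_ball p P r. ereal (\<integral>x. f x \<partial>Q))" for r
  define R where "R r = real_of_ereal (S r) - (\<integral>x. f x \<partial>P) - r * D.sens" for r
  have bounds: "\<forall>\<^sub>F r in at_right 0. 0 < r \<and> ereal ((\<integral>x. f x \<partial>P) + r * (D.sens - e)) \<le> S r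
      \<and> S r \<le> ereal ((\<integral>x. f x \<partial>P) + r * (D.sens + e))" if e: "0 < e" for e
  proof -
    obtain r1 where r1: "0 < r1" "\<And>r Q. 0 < r \<Longrightarrow> r < r1 \<Longrightarrow> Q \<in> adapted_ball p P r \<Longrightarrow>
        (\<integral>x. f x \<partial>Q) \<le> (\<integral>x. f x \<partial>P) + r * (D.sens + e)"
      using D.upper_bound[OF e] by blast
    obtain r2 where r2: "0 < r2" "\<And>r. 0 < r \<Longrightarrow> r < r2 \<Longrightarrow>
        \<exists>Q\<in>adapted_ball p P r. (\<integral>x. f x \<partial>P) + r * (D.sens - e) \<le> (\<integral>x. f x \<partial>Q)"
      using D.lower_bound[OF e] by blast
    show ?thesis unfolding eventually_at_right_field
    proof (intro exI[of _ "min r1 r2"] conjI allI impI)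
      fix r :: real assume r: "0 < r" "r < min r1 r2"
      show "ereal ((\<integral>x. f x \<partial>P) + r * (D.sens - e)) \<le> S r"
        using r2(2)[of r] r unfolding S_def by (auto intro!: SUP_upper2)
      show "S r \<le> ereal ((\<integral>x. f x \<partial>P) + r * (D.sens + e))"
        using r1(2)[of r] r unfolding S_def by (intro SUP_least) auto
    qed (use r1 r2 in auto)
  qed
  have "R \<in> o[at_right 0](\<lambda>r. r)"
  proof (rule landau_o.smallI)
    fix e :: real assume "0 < e"
    from bounds[OF this] show "\<forall>\<^sub>F r in at_right 0. norm (R r) \<le> e * norm r"
    proof eventually_elim
      case (elim r)
      then obtain s where "S r = ereal s" by (cases "S r") auto
      with elim show ?case by (auto simp: R_def algebra_simps abs_le_iff)
    qed
  qed
  moreover have "\<forall>\<^sub>F r in at_right 0. S r = ereal ((\<integral>x. f x \<partial>P) + r * D.sens + R r)"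
    using bounds[OF zero_less_one]
  proof eventually_elim
    case (elim r)
    then obtain s where "S r = ereal s" by (cases "S r") auto
    then show ?case by (simp add: R_def)
  qed
  ultimately show ?thesis
    unfolding S_def D.sens_def D.proj_grad_def pd by blast
qed

end
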